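(* Let $\phi\colon \mathbb{R}^2\to\mathbb{R}^{1+2}$ be a smooth, proper, timelike immersion with vanishing mean curvature. Then $\phi$ is an embedding. Moreover, for each compact subset $K\subseteq\phi(\mathbb{R}^2)$ there is a timelike plane $P\subseteq\mathbb{R}^{1+2}$ such that $K$ is a smooth graph over $P$.
   Context: $\mathbb{R}^{1+2}$ is $\mathbb{R}^3$ with coordinates $(x^0,x^1,x^2)$ and the Minkowski metric $\eta=-(dx^0)^2+(dx^1)^2+(dx^2)^2$. For an immersion $\phi$ of a two-dimensional domain into $\mathbb{R}^{1+2}$, the induced bilinear form is $g_p(X,Y)=\eta(d\phi_p(X),d\phi_p(Y))$; $\phi$ is timelike if $\det(g_p)<0$ at every point $p$. A plane is timelike if $\eta$ restricted to it has negative determinant. For a $C^2$ timelike immersion, vanishing mean curvature means that the mean curvature vector is zero, equivalently $\frac{1}{\sqrt{|\det g|}}\partial_i\big(\sqrt{|\det g|}\,g^{ij}\partial_j\phi^\alpha\big)=0$ for $\alpha=0,1,2$. A set $K$ is a smooth graph over a timelike plane $P$ if, with $n$ an $\eta$-unit normal to $P$, there are a subset $D\subseteq P$ and a real function $u$ on $D$ (the restriction of a smooth function on a neighbourhood of $D$ in $P$) with $K=\{p+u(p)n\colon p\in D\}$. *)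

theory Defs
  imports "HOL-Analysis.Analysis"
begin

section \<open>Smooth maps\<close>

text \<open>Here \<open>S\<close> is meant to be open. On finite-dimensional domains, which are the only ones used
  below, continuity of all directional derivatives of all orders up to \<open>k\<close> amounts to the usual
  notion of a \<open>C\<^sup>k\<close> map.\<close>

primrec Ck_on ::
  "nat \<Rightarrow> 'a set \<Rightarrow> ('a::real_normed_vector \<Rightarrow> 'b::real_normed_vector) \<Rightarrow> bool" where
  "Ck_on 0 S f \<longleftrightarrow> continuous_on S f"
| "Ck_on (Suc k) S f \<longleftrightarrow>
     (\<forall>x\<in>S. f differentiable (at x)) \<and> (\<forall>v. Ck_on k S (\<lambda>x. frechet_derivative f (at x) v))"

definition smooth_on ::
  "'a set \<Rightarrow> ('a::real_normed_vector \<Rightarrow> 'b::real_normed_vector) \<Rightarrow> bool" where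
  "smooth_on S f \<longleftrightarrow> (\<forall>k. Ck_on k S f)"

definition smooth_immersion :: "('a::real_normed_vector \<Rightarrow> 'b::real_normed_vector) \<Rightarrow> bool" where
  "smooth_immersion f \<longleftrightarrow> smooth_on UNIV f \<and> (\<forall>p. inj (frechet_derivative f (at p)))"

definition smooth_embedding :: "('a::real_normed_vector \<Rightarrow> 'b::real_normed_vector) \<Rightarrow> bool" where
  "smooth_embedding f \<longleftrightarrow> smooth_immersion f \<and> embedding_map euclidean euclidean f"

definition partial_deriv :: "'n::finite \<Rightarrow> (real^'n \<Rightarrow> 'b::real_normed_vector) \<Rightarrow> real^'n \<Rightarrow> 'b" where
  "partial_deriv i f p = frechet_derivative f (at p) (axis i 1)"

section \<open>Minkowski space\<close>

text \<open>The index type \<open>3\<close> consists of the three elements \<open>0\<close>, \<open>1\<close>, \<open>2\<close> (with \<open>3 = 0\<close>), so \<open>x $ 0\<close> is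
  the time coordinate.\<close>

definition minkowski :: "real^3 \<Rightarrow> real^3 \<Rightarrow> real" where
  "minkowski x y = - (x $ 0 * y $ 0) + x $ 1 * y $ 1 + x $ 2 * y $ 2"

text \<open>The sign of the determinant of the restricted form does not depend on the basis. Planes are
  taken to be linear.\<close>

definition timelike_plane :: "(real^3) set \<Rightarrow> bool" where
  "timelike_plane P \<longleftrightarrow> subspace P \<and> dim P = 2 \<and>
     (\<exists>b :: 2 \<Rightarrow> real^3. inj b \<and> independent (range b) \<and> span (range b) = P \<and>
        det (\<chi> i j. minkowski (b i) (b j)) < 0)"

definition minkowski_unit_normal :: "(real^3) set \<Rightarrow> real^3 \<Rightarrow> bool" where
  "minkowski_unit_normal P n \<longleftrightarrow> (\<forall>p\<in>P. minkowski n p = 0) \<and> \<bar>minkowski n n\<bar> = 1"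

section \<open>Geometry of immersed surfaces\<close>

definition induced_form :: "(real^2 \<Rightarrow> real^3) \<Rightarrow> real^2 \<Rightarrow> real^2 \<Rightarrow> real^2 \<Rightarrow> real" where
  "induced_form \<phi> p X Y =
     minkowski (frechet_derivative \<phi> (at p) X) (frechet_derivative \<phi> (at p) Y)"

definition induced_matrix :: "(real^2 \<Rightarrow> real^3) \<Rightarrow> real^2 \<Rightarrow> real^2^2" where
  "induced_matrix \<phi> p = (\<chi> i j. induced_form \<phi> p (axis i 1) (axis j 1))"

definition timelike :: "(real^2 \<Rightarrow> real^3) \<Rightarrow> bool" where
  "timelike \<phi> \<longleftrightarrow> (\<forall>p. det (induced_matrix \<phi> p) < 0)"

definition area_density :: "(real^2 \<Rightarrow> real^3) \<Rightarrow> real^2 \<Rightarrow> real" where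
  "area_density \<phi> p = sqrt \<bar>det (induced_matrix \<phi> p)\<bar>"

text \<open>The mean curvature vector of an immersion into flat space, i.e. the trace of its second
  fundamental form, is the Laplace--Beltrami operator of the induced metric applied to the
  coordinate functions \<open>\<phi>\<^sup>\<alpha>\<close>.\<close>

definition mean_curvature_vector :: "(real^2 \<Rightarrow> real^3) \<Rightarrow> real^2 \<Rightarrow> real^3" where
  "mean_curvature_vector \<phi> p = (\<chi> \<alpha>. 1 / area_density \<phi> p *
     (\<Sum>i\<in>UNIV. partial_deriv i
        (\<lambda>q. \<Sum>j\<in>UNIV. area_density \<phi> q * matrix_inv (induced_matrix \<phi> q) $ i $ j *
                partial_deriv j (\<lambda>x. \<phi> x $ \<alpha>) q) p))"

definition vanishing_mean_curvature :: "(real^2 \<Rightarrow> real^3) \<Rightarrow> bool" where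
  "vanishing_mean_curvature \<phi> \<longleftrightarrow> (\<forall>p. mean_curvature_vector \<phi> p = 0)"

section \<open>Graphs over planes\<close>

text \<open>Smoothness of a function on a relatively open subset \<open>U\<close> of a plane \<open>P\<close> is smoothness in a
  linear coordinate system \<open>L\<close> of \<open>P\<close>; the choice of \<open>L\<close> is irrelevant.\<close>

definition smooth_on_plane :: "(real^3) set \<Rightarrow> (real^3) set \<Rightarrow> (real^3 \<Rightarrow> real) \<Rightarrow> bool" where
  "smooth_on_plane P U u \<longleftrightarrow>
     (\<exists>L :: real^2 \<Rightarrow> real^3. linear L \<and> inj L \<and> range L = P \<and> smooth_on (L -` U) (u \<circ> L))"

definition smooth_graph_over :: "(real^3) set \<Rightarrow> (real^3) set \<Rightarrow> bool" where
  "smooth_graph_over K P \<longleftrightarrow>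
     (\<exists>n D U u. minkowski_unit_normal P n \<and> D \<subseteq> U \<and> openin (top_of_set P) U \<and>
        smooth_on_plane P U u \<and> K = (\<lambda>p. p + u p *\<^sub>R n) ` D)"

end

theory Submission
  imports Defs
begin

text \<open>For the Hodge star of the induced metric, vanishing mean curvature says that \<open>\<star>d\<phi>\<close> is closed,
  so that \<open>\<star>d\<phi> = d\<psi>\<close> for some \<open>\<psi>\<close>. As \<open>\<star>\<star> = 1\<close> in Lorentzian signature, \<open>A = (\<phi> + \<psi>)/2\<close> and
  \<open>B = (\<phi> - \<psi>)/2\<close> have differentials with values in null vectors. Hence \<open>d\<phi> = dA + dB\<close> is dominated by
  the differential of \<open>\<Psi> = (A\<^sup>0, B\<^sup>0)\<close>, and since \<open>\<phi>\<close> is proper, \<open>\<Psi>\<close> is a diffeomorphism of the plane.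
  In the coordinates \<open>(s, t) = \<Psi> p\<close> the map becomes \<open>\<phi> = \<alpha> s + \<beta> t\<close> with \<open>\<alpha>' = (1, a)\<close>, \<open>\<beta>' = (1, b)\<close>, where
  \<open>a\<close> and \<open>b\<close> are curves in the unit circle with disjoint images. Over a compact box these images lie
  in disjoint arcs, separated by a line with unit normal \<open>w\<close>, and projecting along the spacelike
  direction orthogonal to \<open>w\<close> is injective on the box: the points with larger \<open>s\<close> and smaller \<open>t\<close> are
  told apart by the separating functional, all others by time.\<close>

section \<open>Calculus of \<open>C\<^sup>k\<close> maps\<close>

text \<open>Properness is given for \<open>\<phi>\<close>, but the map to invert is \<Psi>.
  Domination of d\<phi> by d\<Psi> transfers it: over a ball, a branch of the inverse of \<Psi>
  keeps \<open>\<phi>\<close> bounded, so it stays in a compact set, is Lipschitz there and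
  continues past the boundary. Surjectivity of \<Psi> matters as much as injectivity: every pair (s,
  t) is realised by a point, so the immersion property makes a(s) and b(t) differ for all s and t at
  once. The plane depends on K because nothing keeps the closures of the two full images apart; only
  the arcs over a compact box are strictly separated. Embeddedness comes from the same projections:
  a pair of points is a compact set, so \<open>\<phi>\<close> is injective, and proper maps are
  closed. The curves \<alpha> and \<beta> are only shown to be C^1; smoothness of the graph function
  comes from \<open>\<phi>\<close> and the inverse of the projected surface map.\<close>

lemma Ck_on_continuous: "Ck_on k S f \<Longrightarrow> continuous_on S f"
proof (cases k)
  case (Suc j)
  assume "Ck_on k S f"
  then have "f differentiable_on S"
    using Suc by (simp add: differentiable_on_def differentiable_at_withinI)
  then show ?thesis by (rule differentiable_imp_continuous_on)
qed simp

lemma Ck_on_Suc_imp: "Ck_on (Suc k) S f \<Longrightarrow> Ck_on k S f"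
proof (induction k arbitrary: f)
  case 0
  then show ?case using Ck_on_continuous by (metis Ck_on.simps(1))
next
  case (Suc k)
  then show ?case by simp
qed

lemma Ck_on_subset: "Ck_on k S f \<Longrightarrow> T \<subseteq> S \<Longrightarrow> Ck_on k T f"
  by (induction k arbitrary: f) (auto intro: continuous_on_subset)

text \<open>\<open>frechet_derivative\<close> is a choice among all derivatives, so it is enough
  that both functions have the same candidates; differentiability is not assumed.\<close>

lemma frechet_derivative_cong_open:
  assumes "open S" "x \<in> S" "\<And>x. x \<in> S \<Longrightarrow> f x = g x"
  shows "frechet_derivative f (at x) = frechet_derivative g (at x)"
proof -
  have "(f has_derivative D) (at x) \<longleftrightarrow> (g has_derivative D) (at x)" for D
    using has_derivative_transform_within_open[of f D x UNIV S g]
      has_derivative_transform_within_open[of g D x UNIV S f] assms by auto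
  then show ?thesis unfolding frechet_derivative_def by simp
qed

lemma Ck_on_cong:
  assumes "open S" "\<And>x. x \<in> S \<Longrightarrow> f x = g x" "Ck_on k S f"
  shows "Ck_on k S g"
  using assms(2,3)
proof (induction k arbitrary: f g)
  case 0
  then show ?case using continuous_on_cong[of S S f g] by simp
next
  case (Suc k)
  have "g differentiable (at x)" if "x \<in> S" for x
  proof -
    have "f differentiable (at x)" using Suc.prems(2) \<open>x \<in> S\<close> by simp
    then obtain D where "(f has_derivative D) (at x)" unfolding differentiable_def by blast
    then have "(g has_derivative D) (at x)"
      using has_derivative_transform_within_open[of f D x UNIV S g] Suc.prems(1) \<open>open S\<close> \<open>x \<in> S\<close> by auto
    then show ?thesis unfolding differentiable_def by blast
  qed
  moreover have "Ck_on k S (\<lambda>x. frechet_derivative g (at x) v)" for v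
  proof (rule Suc.IH)
    show "Ck_on k S (\<lambda>x. frechet_derivative f (at x) v)"
      using Suc.prems(2) by simp
    show "frechet_derivative f (at x) v = frechet_derivative g (at x) v" if "x \<in> S" for x
      using frechet_derivative_cong_open[OF \<open>open S\<close> that Suc.prems(1)] by simp
  qed
  ultimately show ?case by simp
qed

text \<open>Admits an explicit formula for the derivative in place of
  \<open>frechet_derivative\<close>, so that each closure property below becomes a differentiation
  rule followed by the induction hypothesis for its terms.\<close>

lemma Ck_on_SucI:
  assumes "open S" "\<And>x. x \<in> S \<Longrightarrow> (f has_derivative f' x) (at x)"
    and "\<And>v. Ck_on k S (\<lambda>x. f' x v)"
  shows "Ck_on (Suc k) S f"
  unfolding Ck_on.simps
proof (intro conjI ballI allI)
  fix x assume "x \<in> S" then show "f differentiable (at x)"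
    using assms(2) differentiable_def by blast
next
  fix v
  have "f' x v = frechet_derivative f (at x) v" if "x \<in> S" for x
    using frechet_derivative_at[OF assms(2)[OF that]] by simp
  then show "Ck_on k S (\<lambda>x. frechet_derivative f (at x) v)"
    using Ck_on_cong[OF assms(1) _ assms(3)[of v]] by simp
qed

lemma Ck_on_Suc_has_derivative:
  assumes "Ck_on (Suc k) S f" "x \<in> S"
  shows "(f has_derivative frechet_derivative f (at x)) (at x)"
  using assms by (simp add: frechet_derivative_works)

lemma Ck_on_const: "open S \<Longrightarrow> Ck_on k S (\<lambda>x. c)"
proof (induction k arbitrary: c)
  case (Suc k)
  then show ?case by (intro Ck_on_SucI[where f' = "\<lambda>x v. 0"]) auto
qed simp

lemma Ck_on_bounded_linear:
  assumes "open S" "bounded_linear L" "Ck_on k S f"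
  shows "Ck_on k S (\<lambda>x. L (f x))"
  using assms(3)
proof (induction k arbitrary: f)
  case 0
  then show ?case using bounded_linear.continuous_on[OF assms(2)] by simp
next
  case (Suc k)
  show ?case
    using Suc.prems
    by (intro Ck_on_SucI[where f' = "\<lambda>x v. L (frechet_derivative f (at x) v)"] Suc.IH assms
          bounded_linear.has_derivative[OF assms(2)] Ck_on_Suc_has_derivative) auto
qed

lemma Ck_on_add:
  assumes "open S" "Ck_on k S f" "Ck_on k S g"
  shows "Ck_on k S (\<lambda>x. f x + g x)"
  using assms(2,3)
proof (induction k arbitrary: f g)
  case 0
  then show ?case by (simp add: continuous_on_add)
next
  case (Suc k)
  show ?case
    by (rule Ck_on_SucI[OF \<open>open S\<close>
            has_derivative_add[OF Ck_on_Suc_has_derivative[OF Suc.prems(1)] Ck_on_Suc_has_derivative[OF Suc.prems(2)]]])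
       (use Suc in auto)
qed

lemma Ck_on_scaleR:
  fixes f :: "'a::real_normed_vector \<Rightarrow> real"
  assumes "open S" "Ck_on k S f" "Ck_on k S g"
  shows "Ck_on k S (\<lambda>x. f x *\<^sub>R g x)"
  using assms(2,3)
proof (induction k arbitrary: f g)
  case 0
  then show ?case by (simp add: continuous_on_scaleR)
next
  case (Suc k)
  show ?case
    by (rule Ck_on_SucI[OF \<open>open S\<close>
            has_derivative_scaleR[OF Ck_on_Suc_has_derivative[OF Suc.prems(1)] Ck_on_Suc_has_derivative[OF Suc.prems(2)]]])
       (use Suc.IH Suc.prems Suc.prems[THEN Ck_on_Suc_imp] in \<open>auto intro!: Ck_on_add[OF \<open>open S\<close>]\<close>)
qed

lemma Ck_on_mult:
  fixes f g :: "'a::real_normed_vector \<Rightarrow> real"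
  assumes "open S" "Ck_on k S f" "Ck_on k S g"
  shows "Ck_on k S (\<lambda>x. f x * g x)"
  using Ck_on_scaleR[OF assms] by simp

lemma Ck_on_minus:
  assumes "open S" "Ck_on k S f"
  shows "Ck_on k S (\<lambda>x. - f x)"
  by (rule Ck_on_bounded_linear[OF assms(1) bounded_linear_minus[OF bounded_linear_ident] assms(2)])

lemma Ck_on_diff:
  assumes "open S" "Ck_on k S f" "Ck_on k S g"
  shows "Ck_on k S (\<lambda>x. f x - g x)"
  using Ck_on_add[OF assms(1,2) Ck_on_minus[OF assms(1,3)]] by simp

lemma Ck_on_sum:
  assumes "open S" "\<And>i. i \<in> I \<Longrightarrow> Ck_on k S (f i)"
  shows "Ck_on k S (\<lambda>x. \<Sum>i\<in>I. f i x)"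
  using assms(2)
  by (induction I rule: infinite_finite_induct) (auto intro!: Ck_on_add Ck_on_const assms(1))

text \<open>The derivative of 1/f is, up to sign, a product of f' and copies of 1/f, and 1/f is
  needed there only one order lower.\<close>

lemma Ck_on_inverse:
  fixes f :: "'a::real_normed_vector \<Rightarrow> real"
  assumes "open S" "Ck_on k S f" "\<And>x. x \<in> S \<Longrightarrow> f x \<noteq> 0"
  shows "Ck_on k S (\<lambda>x. inverse (f x))"
  using assms(2)
proof (induction k)
  case 0
  then show ?case using assms(3) by (simp add: continuous_on_inverse)
next
  case (Suc k)
  show ?case
    by (rule Ck_on_SucI[OF \<open>open S\<close> Deriv.has_derivative_inverse[OF assms(3) Ck_on_Suc_has_derivative[OF Suc.prems]]])
       (use Suc.IH Suc.prems Suc.prems[THEN Ck_on_Suc_imp] in \<open>auto intro!: Ck_on_mult Ck_on_minus assms(1)\<close>)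
qed

lemma Ck_on_sqrt:
  fixes f :: "'a::real_normed_vector \<Rightarrow> real"
  assumes "open S" "Ck_on k S f" "\<And>x. x \<in> S \<Longrightarrow> f x > 0"
  shows "Ck_on k S (\<lambda>x. sqrt (f x))"
  using assms(2)
proof (induction k)
  case 0
  then show ?case by (simp add: continuous_on_real_sqrt)
next
  case (Suc k)
  show ?case
  proof (rule Ck_on_SucI[OF \<open>open S\<close>])
    fix x assume "x \<in> S"
    then show "((\<lambda>x. sqrt (f x)) has_derivative 
        (\<lambda>v. frechet_derivative f (at x) v * (inverse (sqrt (f x)) / 2))) (at x)"
      using Ck_on_Suc_has_derivative[OF Suc.prems, of x] assms(3)[of x]
      by (auto intro!: derivative_eq_intros simp: field_simps)
  next
    fix v
    have "Ck_on k S (\<lambda>x. (1/2) * (frechet_derivative f (at x) v * inverse (sqrt (f x))))"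
      using Suc.IH Suc.prems Suc.prems[THEN Ck_on_Suc_imp] assms(3)
      by (intro Ck_on_mult Ck_on_inverse Ck_on_const assms(1)) (auto simp: order_less_imp_not_eq2)
    then show "Ck_on k S (\<lambda>x. frechet_derivative f (at x) v * (inverse (sqrt (f x)) / 2))"
      by (simp add: mult.commute)
  qed
qed

text \<open>In the chain rule both the point and the direction of the derivative of g vary with x,
  while \<open>Ck_on\<close> speaks of fixed directions. Expanding the direction in the basis leaves
  scalar coefficients times derivatives of g in fixed directions, composed with f, to which the
  induction hypothesis applies.\<close>

lemma Ck_on_compose:
  fixes f :: "'a::real_normed_vector \<Rightarrow> 'b::euclidean_space"
  assumes "open S" "Ck_on k S f" "Ck_on k T g" "f ` S \<subseteq> T"
  shows "Ck_on k S (\<lambda>x. g (f x))"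
  using assms(2,3)
proof (induction k arbitrary: g)
  case 0
  then show ?case using assms(4) continuous_on_compose2 by auto
next
  case (Suc k)
  have f': "(f has_derivative frechet_derivative f (at x)) (at x)" if "x \<in> S" for x
    using Ck_on_Suc_has_derivative[OF Suc.prems(1) that] .
  have g': "(g has_derivative frechet_derivative g (at (f x))) (at (f x))" if "x \<in> S" for x
    using Ck_on_Suc_has_derivative[OF Suc.prems(2)] that assms(4) by blast
  show ?case
  proof (rule Ck_on_SucI[OF \<open>open S\<close>])
    fix x assume "x \<in> S"
    show "((\<lambda>x. g (f x)) has_derivative (\<lambda>v. \<Sum>b\<in>Basis. (frechet_derivative f (at x) v \<bullet> b) *\<^sub>R
        frechet_derivative g (at (f x)) b)) (at x)" (is "(_ has_derivative ?D) _")
    proof -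
      have "?D = (\<lambda>v. frechet_derivative g (at (f x)) (frechet_derivative f (at x) v))"
      proof
        fix v
        interpret G: linear "frechet_derivative g (at (f x))"
          using g'[OF \<open>x \<in> S\<close>] has_derivative_linear by blast
        have "frechet_derivative g (at (f x)) (frechet_derivative f (at x) v) = 
           frechet_derivative g (at (f x)) (\<Sum>b\<in>Basis. (frechet_derivative f (at x) v \<bullet> b) *\<^sub>R b)"
          by (simp add: euclidean_representation)
        then show "?D v = frechet_derivative g (at (f x)) (frechet_derivative f (at x) v)"
          by (simp add: G.sum G.scale)
      qed
      then show ?thesis
        using has_derivative_compose[OF f' g', OF \<open>x \<in> S\<close> \<open>x \<in> S\<close>] by (simp only:)
    qed
  next
    fix v
    show "Ck_on k S (\<lambda>x. \<Sum>b\<in>Basis. (frechet_derivative f (at x) v \<bullet> b) *\<^sub>R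
        frechet_derivative g (at (f x)) b)"
      using Suc.prems Ck_on_Suc_imp[OF Suc.prems(1)]
      by (intro Ck_on_sum Ck_on_scaleR Ck_on_bounded_linear[OF _ bounded_linear_inner_left] Suc.IH assms(1)) auto
  qed
qed

section \<open>Closed one-forms\<close>

text \<open>Poincare lemma on the whole space: the primitive integrates \<omega> along the segment
  from 0 to x. Its derivative in direction h is the integral of \<open>t *\<^sub>R D (t *\<^sub>R x)
  h x + \<omega> (t *\<^sub>R x) h\<close>, and the symmetry of D turns this integrand into the
  t-derivative of \<open>t *\<^sub>R \<omega> (t *\<^sub>R x) h\<close>.\<close>

lemma closed_form_has_primitive:
  fixes \<omega> :: "'a::euclidean_space \<Rightarrow> 'a \<Rightarrow> 'b::banach"
  assumes lin: "\<And>x. linear (\<omega> x)"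
    and D: "\<And>x k. ((\<lambda>x. \<omega> x k) has_derivative (\<lambda>h. D x h k)) (at x)"
    and cont: "\<And>h k. continuous_on UNIV (\<lambda>x. D x h k)"
    and sym: "\<And>x h k. D x h k = D x k h"
  obtains f where "\<And>x. (f has_derivative \<omega> x) (at x)"
proof -
  define fx where "fx x t = Blinfun (\<lambda>h. t *\<^sub>R D (t *\<^sub>R x) h x + \<omega> (t *\<^sub>R x) h)" for x t
  have linD: "linear (\<lambda>h. D x h k)" for x k
    using D has_derivative_linear by blast
  \<comment> \<open>Continuity is assumed for fixed directions only, while the integrand has the
    moving direction x; a finite basis expansion gives joint continuity in x and t.\<close>
  have expandD: "D x h k = (\<Sum>b\<in>Basis. (k \<bullet> b) *\<^sub>R D x h b)" for x h k
  proof -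
    have "D x k h = D x (\<Sum>b\<in>Basis. (k \<bullet> b) *\<^sub>R b) h"
      by (simp add: euclidean_representation)
    also have "\<dots> = (\<Sum>b\<in>Basis. (k \<bullet> b) *\<^sub>R D x b h)"
      by (simp add: linear_sum[OF linD] linear_scale[OF linD])
    finally show ?thesis by (subst (asm) (1 2) sym)
  qed
  have expand\<omega>: "\<omega> x k = (\<Sum>b\<in>Basis. (k \<bullet> b) *\<^sub>R \<omega> x b)" for x k
  proof -
    have "\<omega> x k = \<omega> x (\<Sum>b\<in>Basis. (k \<bullet> b) *\<^sub>R b)"
      by (simp add: euclidean_representation)
    also have "\<dots> = (\<Sum>b\<in>Basis. (k \<bullet> b) *\<^sub>R \<omega> x b)"
      by (simp add: linear_sum[OF lin] linear_scale[OF lin])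
    finally show ?thesis .
  qed
  have "linear (\<lambda>h. t *\<^sub>R D (t *\<^sub>R x) h x + \<omega> (t *\<^sub>R x) h)" for t x
    by (intro linear_compose_add linear_compose_scale_right linD lin)
  then have fx: "blinfun_apply (fx x t) = (\<lambda>h. t *\<^sub>R D (t *\<^sub>R x) h x + \<omega> (t *\<^sub>R x) h)" for x t
    unfolding fx_def by (intro bounded_linear_Blinfun_apply) (simp add: linear_conv_bounded_linear)
  have der: "((\<lambda>x. \<omega> (t *\<^sub>R x) x) has_derivative blinfun_apply (fx x t)) (at x)" for x t
  proof -
    have d1: "((\<lambda>x. \<omega> (t *\<^sub>R x) b) has_derivative (\<lambda>h. t *\<^sub>R D (t *\<^sub>R x) h b)) (at x)" for b
    proof -
      have "((\<lambda>x. \<omega> (t *\<^sub>R x) b) has_derivative (\<lambda>h. D (t *\<^sub>R x) (t *\<^sub>R h) b)) (at x)"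
        by (rule has_derivative_compose[OF _ D]) (auto intro!: derivative_eq_intros)
      then show ?thesis using linear_scale[OF linD] by simp
    qed
    have d2: "((\<lambda>x. \<Sum>b\<in>Basis. (x \<bullet> b) *\<^sub>R \<omega> (t *\<^sub>R x) b) has_derivative
       (\<lambda>h. \<Sum>b\<in>Basis. (x \<bullet> b) *\<^sub>R (t *\<^sub>R D (t *\<^sub>R x) h b) + (h \<bullet> b) *\<^sub>R \<omega> (t *\<^sub>R x) b)) (at x)"
      by (intro has_derivative_sum has_derivative_scaleR d1 bounded_linear_imp_has_derivative bounded_linear_inner_left)
    have eq: "(\<Sum>b\<in>Basis. (x \<bullet> b) *\<^sub>R (t *\<^sub>R D (t *\<^sub>R x) h b) + (h \<bullet> b) *\<^sub>R \<omega> (t *\<^sub>R x) b) = blinfun_apply (fx x t) h" for h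
    proof -
      have "t *\<^sub>R D (t *\<^sub>R x) h x = (\<Sum>b\<in>Basis. (x \<bullet> b) *\<^sub>R (t *\<^sub>R D (t *\<^sub>R x) h b))"
        by (subst expandD) (simp add: scaleR_sum_right mult.commute)
      then show ?thesis
        by (simp only: fx sum.distrib expand\<omega>[of "t *\<^sub>R x" h])
    qed
    show ?thesis
      using d2 by (simp only: eq expand\<omega>[symmetric])
  qed
  have cont\<omega>: "continuous_on UNIV (\<lambda>x. \<omega> x k)" for k
    by (intro continuous_at_imp_continuous_on ballI has_derivative_continuous[OF D])
  have contfx: "continuous_on (UNIV \<times> cbox 0 1) (\<lambda>(x, t::real). fx x t)"
  proof (rule continuous_on_blinfun_componentwise)
    fix i :: 'a
    have "continuous_on (UNIV \<times> cbox 0 1) (\<lambda>z. snd z *\<^sub>R (\<Sum>b\<in>Basis. (fst z \<bullet> b) *\<^sub>R D (snd z *\<^sub>R fst z) i b)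
         + \<omega> (snd z *\<^sub>R fst z) i)"
      by (intro continuous_intros continuous_on_compose2[OF cont] continuous_on_compose2[OF cont\<omega>]) auto
    then show "continuous_on (UNIV \<times> cbox 0 1) (\<lambda>z. blinfun_apply (case z of (x, t::real) \<Rightarrow> fx x t) i)"
      by (simp add: case_prod_unfold fx expandD[symmetric])
  qed
  have conts: "continuous_on S (\<lambda>t. \<omega> (t *\<^sub>R x) k)" for x k and S :: "real set"
    by (intro continuous_on_compose2[OF cont\<omega>] continuous_intros) auto
  define f where "f x = integral (cbox 0 1) (\<lambda>t::real. \<omega> (t *\<^sub>R x) x)" for x
  have "(f has_derivative \<omega> x) (at x)" for x
  proof -
    have "(f has_derivative integral (cbox 0 1) (fx x)) (at x within UNIV)"
      unfolding f_def
    proof (rule leibniz_rule)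
      show "(\<lambda>t. \<omega> (t *\<^sub>R x) x) integrable_on cbox 0 1" for x
        by (rule integrable_continuous[OF conts])
    qed (use der contfx in auto)
    moreover have "integral (cbox 0 1) (fx x) h = \<omega> x h" for h
    proof -
      have cx: "continuous_on {0..1} (fx x)"
      proof -
        have "continuous_on {0..1} (\<lambda>t::real. (x, t))" by (intro continuous_intros)
        then show ?thesis
          using continuous_on_compose2[OF contfx, of "{0..1}" "\<lambda>t. (x, t)"] by auto
      qed
      have "((\<lambda>t. blinfun_apply (fx x t) h) has_integral 1 *\<^sub>R \<omega> (1 *\<^sub>R x) h - 0 *\<^sub>R \<omega> (0 *\<^sub>R x) h) {0..1}"
      proof (rule fundamental_theorem_of_calculus)
        fix t :: real
        have "((\<lambda>t. \<omega> (t *\<^sub>R x) h) has_derivative (\<lambda>s. D (t *\<^sub>R x) (s *\<^sub>R x) h)) (at t)"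
          by (rule has_derivative_compose[OF _ D]) (auto intro!: derivative_eq_intros)
        then have "((\<lambda>t. \<omega> (t *\<^sub>R x) h) has_vector_derivative D (t *\<^sub>R x) x h) (at t)"
          using linear_scale[OF linD] by (simp add: has_vector_derivative_def)
        then have "((\<lambda>t. t *\<^sub>R \<omega> (t *\<^sub>R x) h) has_vector_derivative
            t *\<^sub>R D (t *\<^sub>R x) x h + 1 *\<^sub>R \<omega> (t *\<^sub>R x) h) (at t)"
          by (intro has_vector_derivative_scaleR) auto
        then show "((\<lambda>t. t *\<^sub>R \<omega> (t *\<^sub>R x) h) has_vector_derivative blinfun_apply (fx x t) h) (at t within {0..1})"
          by (simp add: fx sym[of _ x h] has_vector_derivative_at_within)
      qed simp
      then have "integral {0..1} (\<lambda>t. blinfun_apply (fx x t) h) = \<omega> x h"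
        by (simp add: integral_unique)
      moreover have "fx x integrable_on {0..1}"
        using integrable_continuous_real[OF cx] .
      ultimately show ?thesis
        using blinfun_apply_integral[of "fx x" "{0..1}" h] by simp
    qed
    ultimately show ?thesis by (metis (no_types, lifting) ext)
  qed
  then show ?thesis using that by blast
qed

section \<open>A global inverse function theorem\<close>

text \<open>Uniqueness of lifts: the set of agreement is closed as the diagonal is, and open because
  near a common value local injectivity determines the section.\<close>

lemma local_sections_eq:
  fixes f :: "'a::t2_space \<Rightarrow> 'b::topological_space"
  assumes loc: "\<And>x. \<exists>U. open U \<and> x \<in> U \<and> inj_on f U"
    and "connected S" and cont: "continuous_on S \<sigma>" "continuous_on S \<tau>"
    and sec: "\<And>y. y \<in> S \<Longrightarrow> f (\<sigma> y) = y" "\<And>y. y \<in> S \<Longrightarrow> f (\<tau> y) = y"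
    and c: "c \<in> S" "\<sigma> c = \<tau> c" and y: "y \<in> S"
  shows "\<sigma> y = \<tau> y"
proof -
  define E where "E = {y \<in> S. \<sigma> y = \<tau> y}"
  have "closedin (top_of_set S) E"
  proof -
    have "continuous_on S (\<lambda>y. (\<sigma> y, \<tau> y))" by (intro continuous_intros cont)
    then have "closedin (top_of_set S) (S \<inter> (\<lambda>y. (\<sigma> y, \<tau> y)) -` {z. \<exists>x. z = (x, x)})"
      using closed_diagonal by (intro continuous_closedin_preimage) auto
    moreover have "E = S \<inter> (\<lambda>y. (\<sigma> y, \<tau> y)) -` {z. \<exists>x. z = (x, x)}"
      unfolding E_def by auto
    ultimately show ?thesis by simp
  qed
  moreover have "openin (top_of_set S) E"
  proof (subst openin_subopen, intro ballI)
    fix z assume z: "z \<in> E"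
    obtain U where U: "open U" "\<sigma> z \<in> U" "inj_on f U" using loc by blast
    define N where "N = (S \<inter> \<sigma> -` U) \<inter> (S \<inter> \<tau> -` U)"
    have "openin (top_of_set S) N"
      unfolding N_def by (intro openin_Int continuous_openin_preimage_gen cont U)
    moreover have "z \<in> N" using z U(2) unfolding N_def E_def by auto
    moreover have "N \<subseteq> E"
    proof
      fix x assume "x \<in> N"
      then have x: "x \<in> S" "\<sigma> x \<in> U" "\<tau> x \<in> U" unfolding N_def by auto
      then have "\<sigma> x = \<tau> x" using U(3) sec[of x] by (metis inj_onD)
      then show "x \<in> E" using x unfolding E_def by simp
    qed
    ultimately show "\<exists>T. openin (top_of_set S) T \<and> z \<in> T \<and> T \<subseteq> E" by blast
  qed
  ultimately have "E = {} \<or> E = S"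
    using \<open>connected S\<close> unfolding connected_clopen by blast
  then show ?thesis using c y unfolding E_def by blast
qed

text \<open>Otherwise there are pairs of distinct points with equal images ever closer to K. A
  subsequence converges to two points of K with equal images; injectivity on K makes them one point,
  near which local injectivity fails.\<close>

lemma inj_on_compact_imp_nbhd:
  fixes f :: "'a::real_normed_vector \<Rightarrow> 'b::t2_space"
  assumes loc: "\<And>x. x \<in> K \<Longrightarrow> \<exists>U. open U \<and> x \<in> U \<and> inj_on f U"
    and cont: "\<And>x. x \<in> K \<Longrightarrow> isCont f x" and K: "compact K" and inj: "inj_on f K"
  obtains e where "e > 0" "inj_on f (\<Union>x\<in>K. ball x e)"
proof (rule ccontr)
  assume "\<not> thesis"
  have "\<exists>k l x y. k \<in> K \<and> l \<in> K \<and> dist k x < 1 / real (Suc n) \<and> dist l y < 1 / real (Suc n) \<and> f x = f y \<and> x \<noteq> y" for n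
  proof -
    have "\<not> inj_on f (\<Union>x\<in>K. ball x (1 / real (Suc n)))"
      using \<open>\<not> thesis\<close> that[of "1 / real (Suc n)"] by auto
    then obtain x y where "x \<in> (\<Union>x\<in>K. ball x (1 / real (Suc n)))" "y \<in> (\<Union>x\<in>K. ball x (1 / real (Suc n)))"
      "f x = f y" "x \<noteq> y"
      unfolding inj_on_def by blast
    then show ?thesis unfolding UN_iff mem_ball by blast
  qed
  then have "\<forall>n. \<exists>z. fst z \<in> K \<and> fst (snd z) \<in> K \<and> dist (fst z) (fst (snd (snd z))) < 1 / real (Suc n)
      \<and> dist (fst (snd z)) (snd (snd (snd z))) < 1 / real (Suc n)
      \<and> f (fst (snd (snd z))) = f (snd (snd (snd z))) \<and> fst (snd (snd z)) \<noteq> snd (snd (snd z))"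
    unfolding split_paired_Ex fst_conv snd_conv by blast
  from choice[OF this] obtain q where q: "\<forall>n. fst (q n) \<in> K \<and> fst (snd (q n)) \<in> K
      \<and> dist (fst (q n)) (fst (snd (snd (q n)))) < 1 / real (Suc n)
      \<and> dist (fst (snd (q n))) (snd (snd (snd (q n)))) < 1 / real (Suc n)
      \<and> f (fst (snd (snd (q n)))) = f (snd (snd (snd (q n)))) \<and> fst (snd (snd (q n))) \<noteq> snd (snd (snd (q n)))"
    by blast
  define k l x y where "k n = fst (q n)" and "l n = fst (snd (q n))"
    and "x n = fst (snd (snd (q n)))" and "y n = snd (snd (snd (q n)))" for n
  have *: "k n \<in> K" "l n \<in> K" "dist (k n) (x n) < 1 / real (Suc n)"
      "dist (l n) (y n) < 1 / real (Suc n)" "f (x n) = f (y n)" "x n \<noteq> y n" for n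
    using q unfolding k_def l_def x_def y_def by auto
  have "seq_compact (K \<times> K)" using K by (simp add: compact_Times compact_imp_seq_compact)
  then obtain z r where z: "z \<in> K \<times> K" "strict_mono (r :: nat \<Rightarrow> nat)" "((\<lambda>n. (k n, l n)) \<circ> r) \<longlonglongrightarrow> z"
    using seq_compactE[of "K \<times> K" "\<lambda>n. (k n, l n)"] * by (metis SigmaI)
  have z1: "(\<lambda>n. k (r n)) \<longlonglongrightarrow> fst z" and z2: "(\<lambda>n. l (r n)) \<longlonglongrightarrow> snd z"
    using tendsto_fst[OF z(3)] tendsto_snd[OF z(3)] by (auto simp: o_def)
  have "(\<lambda>n. 1 / real (Suc (r n))) \<longlonglongrightarrow> 0"
    using LIMSEQ_subseq_LIMSEQ[OF lim_1_over_n[where 'a=real, THEN LIMSEQ_Suc] z(2)] by (simp add: o_def)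
  then have d: "(\<lambda>n. k (r n) - x (r n)) \<longlonglongrightarrow> 0" "(\<lambda>n. l (r n) - y (r n)) \<longlonglongrightarrow> 0"
    by (rule Lim_null_comparison[rotated], intro always_eventually allI,
        use *(3,4) in \<open>auto intro: less_imp_le simp: dist_norm\<close>)+
  have x: "(\<lambda>n. x (r n)) \<longlonglongrightarrow> fst z" and y: "(\<lambda>n. y (r n)) \<longlonglongrightarrow> snd z"
    by (rule Lim_transform2[OF z1 d(1)], rule Lim_transform2[OF z2 d(2)])
  have "(\<lambda>n. f (x (r n))) \<longlonglongrightarrow> f (fst z)" "(\<lambda>n. f (x (r n))) \<longlonglongrightarrow> f (snd z)"
    using isCont_tendsto_compose[OF cont x] isCont_tendsto_compose[OF cont y] z(1) *(5) by auto
  then have "f (fst z) = f (snd z)" by (rule LIMSEQ_unique)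
  then have eq: "fst z = snd z" using inj_onD[OF inj] z(1) by (simp add: mem_Times_iff)
  obtain U where U: "open U" "fst z \<in> U" "inj_on f U" using loc z(1) by (metis mem_Times_iff)
  have "\<forall>\<^sub>F n in sequentially. x (r n) \<in> U \<and> y (r n) \<in> U"
    using topological_tendstoD[OF x U(1,2)] topological_tendstoD[OF y U(1)] U(2) eq
    by (auto intro: eventually_conj)
  then obtain n where "x (r n) \<in> U" "y (r n) \<in> U"
    using eventually_happens by fastforce
  then show False using U(3) *(5,6) by (metis inj_onD)
qed

text \<open>On the compact image of the section f is injective, hence also on a neighbourhood W of
  it. By invariance of domain f is a homeomorphism from W onto an open set, which contains a larger
  ball. Recording agreement with \<sigma> at the centre is enough, since sections are
  unique.\<close>

lemma section_on_cball_extends: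
  fixes f :: "'a::euclidean_space \<Rightarrow> 'a"
  assumes loc: "\<And>x. \<exists>U. open U \<and> x \<in> U \<and> inj_on f U" and f: "continuous_on UNIV f"
    and \<sigma>: "continuous_on (cball c r) \<sigma>" "\<And>y. y \<in> cball c r \<Longrightarrow> f (\<sigma> y) = y" and "0 \<le> r"
  obtains s \<tau> where "r < s" "continuous_on (ball c s) \<tau>" "\<And>y. y \<in> ball c s \<Longrightarrow> f (\<tau> y) = y" "\<tau> c = \<sigma> c"
proof -
  define K where "K = \<sigma> ` cball c r"
  have "compact K" unfolding K_def using \<sigma>(1) by (intro compact_continuous_image) auto
  moreover have "inj_on f K" unfolding K_def inj_on_def using \<sigma>(2) by auto
  moreover have "isCont f x" for x using f by (simp add: continuous_on_eq_continuous_at)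
  ultimately obtain e where e: "e > 0" "inj_on f (\<Union>x\<in>K. ball x e)"
    using inj_on_compact_imp_nbhd[of K f] loc by metis
  define W where "W = (\<Union>x\<in>K. ball x e)"
  have W: "open W" "inj_on f W" "continuous_on W f"
    using e f continuous_on_subset unfolding W_def by auto
  obtain g where g: "homeomorphism W (f ` W) f g"
    using invariance_of_domain_homeomorphism[of W f] W by auto
  have "open (f ` W)" using invariance_of_domain W by blast
  moreover have "cball c r \<subseteq> f ` W"
  proof
    fix y assume y: "y \<in> cball c r"
    then have "\<sigma> y \<in> W" using e(1) unfolding W_def K_def by force
    then show "y \<in> f ` W" using \<sigma>(2)[OF y] by force
  qed
  ultimately obtain d where d: "d > 0" "(\<Union>x\<in>cball c r. ball x d) \<subseteq> f ` W"
    using compact_subset_open_imp_ball_epsilon_subset[OF compact_cball] by metis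
  have sub: "ball c (r + d) \<subseteq> f ` W"
  proof
    fix y assume y: "y \<in> ball c (r + d)"
    show "y \<in> f ` W"
    proof (cases "dist c y \<le> r")
      case True
      then show ?thesis using d by force
    next
      case False
      \<comment> \<open>The radial projection of y to the sphere of radius r, the point of the
        closed ball nearest to y.\<close>
      define z where "z = c + (r / dist c y) *\<^sub>R (y - c)"
      have pos: "dist c y > 0" using False \<open>0 \<le> r\<close> by linarith
      have "dist c z = r"
        unfolding z_def using pos \<open>0 \<le> r\<close> by (simp add: dist_norm norm_minus_commute)
      moreover have "dist z y < d"
      proof -
        have "y - z = (1 - r / dist c y) *\<^sub>R (y - c)"
          unfolding z_def by (simp add: algebra_simps)
        then have "dist z y = \<bar>1 - r / dist c y\<bar> * dist c y"
          by (simp add: dist_norm norm_minus_commute)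
        also have "\<dots> = dist c y - r"
          using pos False by (simp add: abs_if field_simps)
        also have "\<dots> < d" using y by simp
        finally show ?thesis .
      qed
      ultimately have "y \<in> (\<Union>x\<in>cball c r. ball x d)" by auto
      then show ?thesis using d(2) by blast
    qed
  qed
  show ?thesis
  proof (rule that[of "r + d" g])
    show "continuous_on (ball c (r + d)) g"
      using homeomorphism_cont2[OF g] continuous_on_subset sub by blast
    show "f (g y) = y" if "y \<in> ball c (r + d)" for y
      using homeomorphism_apply2[OF g] sub that by blast
    have "c \<in> cball c r" using \<open>0 \<le> r\<close> by simp
    then have "\<sigma> c \<in> W" using e(1) unfolding W_def K_def by (intro UN_I[of "\<sigma> c"] imageI) auto
    then show "g c = \<sigma> c"
      using homeomorphism_apply1[OF g, of "\<sigma> c"] \<sigma>(2)[of c] \<open>0 \<le> r\<close> by simp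
  qed (use d in auto)
qed

text \<open>Two balls about c meet in a convex set containing c, where all sections take the value
  \<open>x0\<close>; uniqueness of lifts then makes them agree.\<close>

lemma glue_sections_on_balls:
  fixes f :: "'a::euclidean_space \<Rightarrow> 'a"
  assumes loc: "\<And>x. \<exists>U. open U \<and> x \<in> U \<and> inj_on f U" and pos: "\<And>r. r \<in> I \<Longrightarrow> 0 < r" and "I \<noteq> {}"
    and sec: "\<And>r. r \<in> I \<Longrightarrow> \<exists>\<sigma>. continuous_on (ball c r) \<sigma> \<and> (\<forall>y\<in>ball c r. f (\<sigma> y) = y) \<and> \<sigma> c = x0"
  obtains \<sigma> where "continuous_on (\<Union>r\<in>I. ball c r) \<sigma>" "\<And>y. y \<in> (\<Union>r\<in>I. ball c r) \<Longrightarrow> f (\<sigma> y) = y" "\<sigma> c = x0"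
proof -
  obtain \<tau> where \<tau>: "\<And>r. r \<in> I \<Longrightarrow> continuous_on (ball c r) (\<tau> r)"
    "\<And>r y. r \<in> I \<Longrightarrow> y \<in> ball c r \<Longrightarrow> f (\<tau> r y) = y" "\<And>r. r \<in> I \<Longrightarrow> \<tau> r c = x0"
    using sec by metis
  have agree: "\<tau> r y = \<tau> s y" if "r \<in> I" "s \<in> I" "y \<in> ball c r" "y \<in> ball c s" for r s y
  proof (rule local_sections_eq[where f = f and S = "ball c r \<inter> ball c s" and \<sigma> = "\<tau> r" and \<tau> = "\<tau> s" and c = c, OF loc])
    show "connected (ball c r \<inter> ball c s)"
      by (intro convex_connected convex_Int convex_ball)
    show "continuous_on (ball c r \<inter> ball c s) (\<tau> r)" "continuous_on (ball c r \<inter> ball c s) (\<tau> s)"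
      using \<tau>(1) that continuous_on_subset by blast+
  qed (use that \<tau>(2,3) pos in auto)
  define \<sigma> where "\<sigma> y = \<tau> (SOME r. r \<in> I \<and> y \<in> ball c r) y" for y
  have \<sigma>: "\<sigma> y = \<tau> r y" if "r \<in> I" "y \<in> ball c r" for r y
    using agree that someI_ex[of "\<lambda>r. r \<in> I \<and> y \<in> ball c r"] unfolding \<sigma>_def by blast
  show ?thesis
  proof (rule that[of \<sigma>])
    show "continuous_on (\<Union>r\<in>I. ball c r) \<sigma>"
    proof (rule continuous_on_open_UN)
      fix r assume r: "r \<in> I"
      show "continuous_on (ball c r) \<sigma>"
        using \<tau>(1)[OF r] \<sigma>[OF r] continuous_on_cong[of "ball c r" "ball c r" \<sigma> "\<tau> r"] by simp
    qed auto
    show "f (\<sigma> y) = y" if "y \<in> (\<Union>r\<in>I. ball c r)" for y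
      using that \<sigma> \<tau>(2) by force
    show "\<sigma> c = x0"
      using \<sigma> \<tau>(3) pos \<open>I \<noteq> {}\<close> by (metis centre_in_ball equals0I)
  qed
qed

lemma C1_locally_injective:
  fixes f :: "'a::euclidean_space \<Rightarrow> 'a"
  assumes f': "\<And>x. (f has_derivative f' x) (at x)" and cont: "\<And>v. continuous_on UNIV (\<lambda>x. f' x v)"
    and inj: "\<And>x. inj (f' x)"
  shows "\<exists>U. open U \<and> x \<in> U \<and> inj_on f U"
proof -
  have bl: "bounded_linear (f' x)" for x using has_derivative_bounded_linear[OF f'] .
  have ap: "blinfun_apply (Blinfun (f' x)) = f' x" for x
    using bl by (simp add: bounded_linear_Blinfun_apply)
  have contB: "continuous_on UNIV (\<lambda>x. Blinfun (f' x))"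
    by (rule continuous_on_blinfun_componentwise) (simp add: ap cont)
  obtain g where g: "linear g" "g \<circ> f' x = id"
    using linear_injective_left_inverse[of "f' x"] inj bl bounded_linear.linear by blast
  then have inv: "Blinfun g o\<^sub>L Blinfun (f' x) = id_blinfun"
    by (intro blinfun_eqI)
      (auto simp: ap bounded_linear_Blinfun_apply linear_conv_bounded_linear[symmetric] fun_eq_iff)
  have der: "(f has_derivative blinfun_apply (Blinfun (f' x))) (at x)" if "x \<in> UNIV" for x
    by (simp add: ap f')
  show ?thesis
  proof (rule inverse_function_theorem[OF open_UNIV der contB UNIV_I inv])
    fix U V h assume "open U" "x \<in> U" "homeomorphism U V f h"
    then show ?thesis
      using homeomorphism_apply1 inj_on_inverseI by metis
  qed
qed

text \<open>The constant is the minimum over the compact set of pairs of a point of M and a unit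
  vector, positive by injectivity; homogeneity extends the bound to all vectors.\<close>

lemma injective_derivative_bounded_below:
  fixes f' :: "'a::euclidean_space \<Rightarrow> 'b::euclidean_space \<Rightarrow> 'c::real_normed_vector"
  assumes lin: "\<And>x. linear (f' x)" and cont: "\<And>v. continuous_on UNIV (\<lambda>x. f' x v)"
    and inj: "\<And>x. inj (f' x)" and "compact M"
  obtains m where "m > 0" "\<And>x h. x \<in> M \<Longrightarrow> m * norm h \<le> norm (f' x h)"
proof (cases "M = {}")
  case True
  then show ?thesis using that[of 1] by simp
next
  case False
  let ?F = "\<lambda>z. norm (f' (fst z) (snd z))"
  have expand: "f' x h = (\<Sum>b\<in>Basis. (h \<bullet> b) *\<^sub>R f' x b)" for x h
  proof -
    have "f' x h = f' x (\<Sum>b\<in>Basis. (h \<bullet> b) *\<^sub>R b)"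
      by (simp add: euclidean_representation)
    also have "\<dots> = (\<Sum>b\<in>Basis. (h \<bullet> b) *\<^sub>R f' x b)"
      by (simp add: linear_sum[OF lin] linear_scale[OF lin])
    finally show ?thesis .
  qed
  have "continuous_on (M \<times> sphere 0 1) (\<lambda>z. norm (\<Sum>b\<in>Basis. (snd z \<bullet> b) *\<^sub>R f' (fst z) b))"
    by (intro continuous_intros continuous_on_compose2[OF cont]) auto
  then have c: "continuous_on (M \<times> sphere 0 1) ?F"
    by (simp only: expand[symmetric])
  have "compact (M \<times> sphere (0::'b) 1)" using \<open>compact M\<close> by (simp add: compact_Times)
  moreover have "M \<times> sphere (0::'b) 1 \<noteq> {}" using False by simp
  ultimately have "\<exists>z\<in>M \<times> sphere 0 1. \<forall>w\<in>M \<times> sphere 0 1. ?F z \<le> ?F w"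
    by (rule continuous_attains_inf[OF _ _ c])
  then obtain z where z: "z \<in> M \<times> sphere 0 1" "\<forall>w\<in>M \<times> sphere 0 1. ?F z \<le> ?F w"
    by (rule bexE)
  show ?thesis
  proof (rule that[of "?F z"])
    have "snd z \<noteq> 0" using z(1) by auto
    then have "f' (fst z) (snd z) \<noteq> 0"
      using inj[of "fst z"] linear_injective_0[OF lin, of "fst z"] by auto
    then show "?F z > 0" by simp
    fix x h assume x: "x \<in> M"
    show "?F z * norm h \<le> norm (f' x h)"
    proof (cases "h = 0")
      case False
      have "?F z \<le> norm (f' x (h /\<^sub>R norm h))"
        using bspec[OF z(2), of "(x, h /\<^sub>R norm h)"] x False by simp
      also have "\<dots> = norm (f' x h) / norm h"
        unfolding linear_scale[OF lin] by (simp add: divide_inverse_commute)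
      finally show ?thesis using False by (simp only: pos_le_divide_eq zero_less_norm_iff not_False_eq_True)
    qed simp
  qed
qed

lemma has_derivative_section:
  fixes f :: "'a::euclidean_space \<Rightarrow> 'a"
  assumes f': "(f has_derivative f') (at (\<sigma> y))" and inj: "inj f'"
    and "open S" "y \<in> S" "continuous_on S \<sigma>" "\<And>y. y \<in> S \<Longrightarrow> f (\<sigma> y) = y"
  shows "(\<sigma> has_derivative inv f') (at y)"
proof -
  have lin: "linear f'" by (rule has_derivative_linear[OF f'])
  have "linear (inv f')"
    by (rule inj_linear_imp_inv_linear[OF lin inj])
  moreover have "inv f' \<circ> f' = id"
    by (rule inv_o_cancel[OF inj])
  moreover have "continuous (at y) \<sigma>"
    using assms(3-5) by (simp add: continuous_on_eq_continuous_at)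
  ultimately show ?thesis
    using has_derivative_inverse_basic[where f = f and f' = f' and g' = "inv f'" and g = \<sigma> and y = y and T = S]
      f' assms(3,4,6) by (simp add: linear_conv_bounded_linear)
qed

text \<open>A Hadamard type theorem. A section of f is continued over growing balls; at a finite
  maximal radius, domination bounds \<open>\<phi>\<close> along the section, properness confines the
  section to a compact set, and the lower bound of f' there makes it Lipschitz, so it reaches the
  closed ball and extends beyond. The resulting global section is also a left inverse.\<close>

theorem bijective_of_dominated_proper_map:
  fixes f :: "'a::euclidean_space \<Rightarrow> 'a" and \<phi> :: "'a \<Rightarrow> 'b::euclidean_space"
  assumes f': "\<And>x. (f has_derivative f' x) (at x)" and cont: "\<And>v. continuous_on UNIV (\<lambda>x. f' x v)"
    and inj: "\<And>x. inj (f' x)"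
    and \<phi>': "\<And>x. (\<phi> has_derivative \<phi>' x) (at x)" and le: "\<And>x h. norm (\<phi>' x h) \<le> C * norm (f' x h)"
    and proper: "proper_map euclidean euclidean \<phi>"
  obtains \<sigma> where "\<And>y. f (\<sigma> y) = y" "\<And>x. \<sigma> (f x) = x" "\<And>y. (\<sigma> has_derivative inv (f' (\<sigma> y))) (at y)"
proof -
  note loc = C1_locally_injective[of f f', OF f' cont inj]
  have lin: "linear (f' x)" for x by (rule has_derivative_linear[OF f'])
  have cf: "continuous_on UNIV f"
    by (intro continuous_at_imp_continuous_on ballI has_derivative_continuous[OF f'])
  define x0 :: 'a where "x0 = 0"
  define c where "c = f x0"
  define I where "I = {r. 0 < r \<and> (\<exists>\<sigma>. continuous_on (ball c r) \<sigma> \<and> (\<forall>y\<in>ball c r. f (\<sigma> y) = y) \<and> \<sigma> c = x0)}"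
  have I: "0 < r" "\<exists>\<sigma>. continuous_on (ball c r) \<sigma> \<and> (\<forall>y\<in>ball c r. f (\<sigma> y) = y) \<and> \<sigma> c = x0" if "r \<in> I" for r
    using that unfolding I_def by auto
  have extend: "\<exists>s\<in>I. r < s"
    if r: "0 \<le> r" "continuous_on (cball c r) \<sigma>" "\<And>y. y \<in> cball c r \<Longrightarrow> f (\<sigma> y) = y" "\<sigma> c = x0" for r \<sigma>
  proof (rule section_on_cball_extends[OF loc cf r(2) _ r(1)])
    show "f (\<sigma> y) = y" if "y \<in> cball c r" for y by (rule r(3)[OF that])
  next
    fix s \<tau>
    assume \<tau>: "r < s" "continuous_on (ball c s) \<tau>" "\<And>y. y \<in> ball c s \<Longrightarrow> f (\<tau> y) = y" "\<tau> c = \<sigma> c"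
    have "\<forall>y\<in>ball c s. f (\<tau> y) = y" using \<tau>(3) by blast
    moreover have "\<tau> c = x0" "0 < s" using \<tau>(1,4) r(1,4) by simp_all
    ultimately have "s \<in> I" using \<tau>(2) unfolding I_def by blast
    then show ?thesis using \<tau>(1) by blast
  qed
  \<comment> \<open>The closed ball of radius 0 is a point, so the constant section starts the
    continuation.\<close>
  have "\<exists>s\<in>I. 0 < s"
    by (rule extend[of 0 "\<lambda>_. x0"]) (simp_all add: c_def)
  then have "I \<noteq> {}" by blast
  have "(\<Union>r\<in>I. ball c r) = UNIV"
  proof (rule ccontr)
    assume "(\<Union>r\<in>I. ball c r) \<noteq> UNIV"
    then obtain b where "b \<notin> (\<Union>r\<in>I. ball c r)" by blast
    then have bdd: "bdd_above I" by (intro bdd_aboveI[of _ "dist c b"]) (simp add: not_less)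
    define R where "R = Sup I"
    have le_R: "r \<le> R" if "r \<in> I" for r
      unfolding R_def by (rule cSup_upper[OF that bdd])
    have R0: "0 < R"
      using \<open>I \<noteq> {}\<close> I(1) le_R by (meson ex_in_conv less_le_trans)
    have ballR: "(\<Union>r\<in>I. ball c r) = ball c R"
    proof
      show "(\<Union>r\<in>I. ball c r) \<subseteq> ball c R" using le_R by force
      show "ball c R \<subseteq> (\<Union>r\<in>I. ball c r)"
      proof
        fix y assume "y \<in> ball c R"
        then have "\<exists>r\<in>I. dist c y < r"
          unfolding R_def mem_ball less_cSup_iff[OF \<open>I \<noteq> {}\<close> bdd] .
        then show "y \<in> (\<Union>r\<in>I. ball c r)" by simp
      qed
    qed
    obtain \<sigma> where \<sigma>: "continuous_on (ball c R) \<sigma>" "\<And>y. y \<in> ball c R \<Longrightarrow> f (\<sigma> y) = y" "\<sigma> c = x0"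
      using glue_sections_on_balls[of f I c x0, OF loc I(1) \<open>I \<noteq> {}\<close> I(2), unfolded ballR] by metis
    have \<sigma>': "(\<sigma> has_derivative inv (f' (\<sigma> y))) (at y)" if "y \<in> ball c R" for y
      by (rule has_derivative_section[OF f' inj open_ball that \<sigma>(1,2)])
    have inv: "f' x (inv (f' x) k) = k" for x k
      using linear_inj_imp_surj[OF lin inj] by (simp add: surj_f_inv_f)
    have bound: "dist (\<phi> x0) (\<phi> (\<sigma> y)) \<le> \<bar>C\<bar> * R" if y: "y \<in> ball c R" for y
    proof -
      have "norm (\<phi> (\<sigma> y) - \<phi> (\<sigma> c)) \<le> \<bar>C\<bar> * norm (y - c)"
      proof (rule differentiable_bound[of "ball c R"])
        show "((\<lambda>y. \<phi> (\<sigma> y)) has_derivative (\<lambda>k. \<phi>' (\<sigma> z) (inv (f' (\<sigma> z)) k))) (at z within ball c R)"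
          if "z \<in> ball c R" for z
          by (rule has_derivative_at_withinI[OF has_derivative_compose[OF \<sigma>'[OF that] \<phi>']])
        show "onorm (\<lambda>k. \<phi>' (\<sigma> z) (inv (f' (\<sigma> z)) k)) \<le> \<bar>C\<bar>" for z
        proof (rule onorm_bound)
          fix k
          have "norm (\<phi>' (\<sigma> z) (inv (f' (\<sigma> z)) k)) \<le> C * norm k"
            using le[of "\<sigma> z" "inv (f' (\<sigma> z)) k"] by (simp add: inv)
          also have "\<dots> \<le> \<bar>C\<bar> * norm k" by (intro mult_right_mono) auto
          finally show "norm (\<phi>' (\<sigma> z) (inv (f' (\<sigma> z)) k)) \<le> \<bar>C\<bar> * norm k" .
        qed simp
      qed (use y R0 in auto)
      also have "\<dots> \<le> \<bar>C\<bar> * R"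
        using y by (intro mult_left_mono) (auto simp: dist_norm norm_minus_commute)
      finally show ?thesis using \<sigma>(3) by (simp add: dist_norm norm_minus_commute)
    qed
    \<comment> \<open>Properness enters here: the section takes its values in this preimage of a
      closed ball, which is compact although no bound on the section itself is known yet.\<close>
    define M where "M = {x. \<phi> x \<in> cball (\<phi> x0) (\<bar>C\<bar> * R)}"
    have "compact M"
      using compactin_proper_map_preimage[OF proper, of "cball (\<phi> x0) (\<bar>C\<bar> * R)"] unfolding M_def by simp
    obtain m where m: "m > 0" "\<And>x h. x \<in> M \<Longrightarrow> m * norm h \<le> norm (f' x h)"
      using injective_derivative_bounded_below[OF lin cont inj \<open>compact M\<close>] by metis
    have lip: "norm (\<sigma> y - \<sigma> z) \<le> (1 / m) * norm (y - z)" if "y \<in> ball c R" "z \<in> ball c R" for y z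
    proof (rule differentiable_bound[of "ball c R"])
      show "(\<sigma> has_derivative inv (f' (\<sigma> w))) (at w within ball c R)" if "w \<in> ball c R" for w
        by (rule has_derivative_at_withinI[OF \<sigma>'[OF that]])
      show "onorm (inv (f' (\<sigma> w))) \<le> 1 / m" if w: "w \<in> ball c R" for w
      proof (rule onorm_bound)
        fix k
        have "\<sigma> w \<in> M" using bound[OF w] unfolding M_def by simp
        then have "m * norm (inv (f' (\<sigma> w)) k) \<le> norm k"
          using m(2)[of "\<sigma> w" "inv (f' (\<sigma> w)) k"] by (simp add: inv)
        then show "norm (inv (f' (\<sigma> w)) k) \<le> 1 / m * norm k"
          using m(1) by (simp add: field_simps)
      qed (use m(1) in simp)
    qed (use that in auto)
    \<comment> \<open>Uniform continuity extends the section to the closed ball, and the section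
      identity persists there by continuity; this contradicts the maximality of R.\<close>
    have "(1 / m)-lipschitz_on (ball c R) \<sigma>"
      by (rule lipschitz_onI) (use lip m(1) in \<open>auto simp: dist_norm\<close>)
    then have "uniformly_continuous_on (ball c R) \<sigma>"
      by (rule lipschitz_on_uniformly_continuous)
    then obtain g where g: "uniformly_continuous_on (closure (ball c R)) g" "\<And>y. y \<in> ball c R \<Longrightarrow> \<sigma> y = g y"
      using uniformly_continuous_on_extension_on_closure by metis
    have cg: "continuous_on (cball c R) g"
      using uniformly_continuous_imp_continuous[OF g(1)] R0 by simp
    have "f (g y) - y = 0" if "y \<in> cball c R" for y
    proof (rule continuous_constant_on_closure[of "ball c R" "\<lambda>y. f (g y) - y" 0])
      show "continuous_on (closure (ball c R)) (\<lambda>y. f (g y) - y)"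
        using R0 cg by (auto intro!: continuous_intros continuous_on_compose2[OF cf])
      show "f (g x) - x = 0" if "x \<in> ball c R" for x
        using \<sigma>(2)[OF that] g(2)[OF that] by simp
    qed (use that R0 in auto)
    then have fg: "f (g y) = y" if "y \<in> cball c R" for y
      using that by simp
    have "g c = x0" using g(2)[of c] \<sigma>(3) R0 by simp
    then have "\<exists>s\<in>I. R < s"
      using extend[OF _ cg fg] R0 by simp
    then show False using le_R by (meson not_le)
  qed
  note UNIV = this
  obtain \<sigma> where \<sigma>: "continuous_on UNIV \<sigma>" "\<And>y. f (\<sigma> y) = y"
    using glue_sections_on_balls[of f I c x0, OF loc I(1) \<open>I \<noteq> {}\<close> I(2), unfolded UNIV] by (metis UNIV_I)
  \<comment> \<open>The range is open by invariance of domain and closed as the fixed point set of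
    \<sigma> after f, hence everything; so f has no points outside this one branch.\<close>
  have "inj \<sigma>" using \<sigma>(2) by (metis injI)
  then have "open (range \<sigma>)"
    using invariance_of_domain[OF \<sigma>(1)] by simp
  moreover have "closed (range \<sigma>)"
  proof -
    have "closed {x. \<sigma> (f x) = x}"
      by (intro closed_Collect_eq continuous_on_compose2[OF \<sigma>(1) cf] continuous_intros) auto
    moreover have "range \<sigma> = {x. \<sigma> (f x) = x}"
      using \<sigma>(2) by (auto intro: rangeI) (metis rangeI)
    ultimately show ?thesis by simp
  qed
  ultimately have "range \<sigma> = UNIV"
    using clopen by blast
  then have "\<sigma> (f x) = x" for x
    using \<sigma>(2) by (metis UNIV_I image_iff)
  moreover have "(\<sigma> has_derivative inv (f' (\<sigma> y))) (at y)" for y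
    by (rule has_derivative_section[OF f' inj open_UNIV UNIV_I \<sigma>])
  ultimately show ?thesis by (rule that[OF \<sigma>(2)])
qed

section \<open>Disjoint curves in the circle\<close>

text \<open>The line is contractible, so the curve has a continuous logarithm; unit modulus makes
  its real part vanish.\<close>

lemma unit_curve_angle:
  fixes a :: "real \<Rightarrow> complex"
  assumes "continuous_on UNIV a" "\<And>s. norm (a s) = 1"
  obtains \<theta> where "continuous_on UNIV \<theta>" "\<And>s. a s = cis (\<theta> s)"
proof -
  obtain g where g: "continuous_on UNIV g" "\<And>s. a s = exp (g s)"
    using continuous_logarithm_on_contractible[OF assms(1)] assms(2)
    by (metis UNIV_I contractible_UNIV norm_zero zero_neq_one)
  have "a s = cis (Im (g s))" for s
  proof -
    have "exp (Re (g s)) = 1" using g(2)[of s] assms(2)[of s] by (simp add: norm_exp_eq_Re)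
    then show ?thesis using g(2)[of s] exp_eq_polar[of "g s"] by simp
  qed
  moreover have "continuous_on UNIV (\<lambda>s. Im (g s))"
    by (intro continuous_intros g)
  ultimately show ?thesis using that by blast
qed

text \<open>Disjointness says that the angle difference divided by 2 pi is never an integer. Its
  range over all pairs (s, t) is connected, hence lies between consecutive integers k and k + 1, and
  shifting \<kappa> by 2 pi k brings the difference into the interval from 0 to 2 pi.\<close>

lemma disjoint_circle_curves_angles:
  fixes a b :: "real \<Rightarrow> complex"
  assumes "continuous_on UNIV a" "continuous_on UNIV b"
    and "\<And>s. norm (a s) = 1" "\<And>t. norm (b t) = 1" "\<And>s t. a s \<noteq> b t"
  obtains \<theta> \<kappa> where "continuous_on UNIV \<theta>" "continuous_on UNIV \<kappa>"
    "\<And>s. a s = cis (\<theta> s)" "\<And>t. b t = cis (\<kappa> t)"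
    "\<And>s t. 0 < \<theta> s - \<kappa> t" "\<And>s t. \<theta> s - \<kappa> t < 2 * pi"
proof -
  obtain \<theta> where \<theta>: "continuous_on UNIV \<theta>" "\<And>s. a s = cis (\<theta> s)"
    using unit_curve_angle[OF assms(1,3)] by blast
  obtain \<kappa> where \<kappa>: "continuous_on UNIV \<kappa>" "\<And>s. b s = cis (\<kappa> s)"
    using unit_curve_angle[OF assms(2,4)] by blast
  define h where "h z = (\<theta> (fst z) - \<kappa> (snd z)) / (2 * pi)" for z
  have "continuous_on UNIV h"
    unfolding h_def
    by (intro continuous_intros continuous_on_compose2[OF \<theta>(1)] continuous_on_compose2[OF \<kappa>(1)]) auto
  then have conn: "connected (range h)"
    by (rule connected_continuous_image) (metis UNIV_Times_UNIV connected_Times connected_UNIV)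
  have notint: "real_of_int k \<notin> range h" for k
  proof
    assume "real_of_int k \<in> range h"
    then obtain s t where "\<theta> s - \<kappa> t = 2 * pi * of_int k"
      unfolding h_def by (auto simp: field_simps)
    then have "\<theta> s = \<kappa> t + 2 * pi * of_int k" by simp
    then have "cis (\<theta> s) = cis (\<kappa> t)"
      by (simp add: cis_mult[symmetric] cis_multiple_2pi)
    then show False using assms(5)[of s t] \<theta> \<kappa> by simp
  qed
  define k where "k = \<lfloor>h (0,0)\<rfloor>"
  have k: "of_int k \<le> h (0,0)" "h (0,0) \<le> of_int (k + 1)"
    unfolding k_def using floor_correct[of "h (0,0)"] by linarith+
  have lo: "of_int k < h z" for z
  proof (rule ccontr)
    assume "\<not> of_int k < h z"
    then have "of_int k \<in> range h"
      using connectedD_interval[OF conn, of "h z" "h (0,0)" "of_int k"] k by auto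
    then show False using notint by blast
  qed
  have hi: "h z < of_int (k + 1)" for z
  proof (rule ccontr)
    assume "\<not> h z < of_int (k + 1)"
    then have "of_int (k + 1) \<in> range h"
      using connectedD_interval[OF conn, of "h (0,0)" "h z" "of_int (k + 1)"] k by auto
    then show False using notint by blast
  qed
  define \<kappa>' where "\<kappa>' t = \<kappa> t + 2 * pi * of_int k" for t
  show ?thesis
  proof (rule that[of \<theta> \<kappa>'])
    show "continuous_on UNIV \<kappa>'" unfolding \<kappa>'_def by (intro continuous_intros \<kappa>)
    show "b t = cis (\<kappa>' t)" for t
      unfolding \<kappa>'_def using \<kappa>(2) by (simp add: cis_mult[symmetric] cis_multiple_2pi)
    show "0 < \<theta> s - \<kappa>' t" "\<theta> s - \<kappa>' t < 2 * pi" for s t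
      using lo[of "(s,t)"] hi[of "(s,t)"] unfolding h_def \<kappa>'_def by (auto simp: field_simps)
  qed (use \<theta> in auto)
qed

text \<open>The separating line is the chord whose ends halve the two gaps between the arcs.\<close>

lemma disjoint_circle_curves_separation:
  fixes a b :: "real \<Rightarrow> complex"
  assumes "continuous_on UNIV a" "continuous_on UNIV b"
    and "\<And>s. norm (a s) = 1" "\<And>t. norm (b t) = 1" "\<And>s t. a s \<noteq> b t"
    and "compact S" "compact T" "S \<noteq> {}" "T \<noteq> {}"
  obtains w c where "norm w = 1" "\<And>s. s \<in> S \<Longrightarrow> c < w \<bullet> a s" "\<And>t. t \<in> T \<Longrightarrow> w \<bullet> b t < c"
proof -
  obtain \<theta> \<kappa> where cont: "continuous_on UNIV \<theta>" "continuous_on UNIV \<kappa>"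
    and ab: "\<And>s. a s = cis (\<theta> s)" "\<And>t. b t = cis (\<kappa> t)"
    and gap: "\<And>s t. 0 < \<theta> s - \<kappa> t" "\<And>s t. \<theta> s - \<kappa> t < 2 * pi"
    using disjoint_circle_curves_angles[OF assms(1-5)] by metis
  note c\<theta> = continuous_on_subset[OF cont(1) subset_UNIV] and c\<kappa> = continuous_on_subset[OF cont(2) subset_UNIV]
  obtain s0 where s0: "\<And>s. s \<in> S \<Longrightarrow> \<theta> s0 \<le> \<theta> s"
    using continuous_attains_inf[OF assms(6,8) c\<theta>] by blast
  obtain s1 where s1: "s1 \<in> S" "\<And>s. s \<in> S \<Longrightarrow> \<theta> s \<le> \<theta> s1"
    using continuous_attains_sup[OF assms(6,8) c\<theta>] by blast
  obtain t0 where t0: "\<And>t. t \<in> T \<Longrightarrow> \<kappa> t0 \<le> \<kappa> t"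
    using continuous_attains_inf[OF assms(7,9) c\<kappa>] by blast
  obtain t1 where t1: "t1 \<in> T" "\<And>t. t \<in> T \<Longrightarrow> \<kappa> t \<le> \<kappa> t1"
    using continuous_attains_sup[OF assms(7,9) c\<kappa>] by blast
  \<comment> \<open>\<open>m1\<close> and \<open>m2\<close> are the middles of the gaps before and
    after the arc of a. The arc between them has centre \<open>m\<close> and half-width
    \<open>d\<close>, so its chord is the line where the inner product with \<open>cis m\<close>
    equals \<open>cos d\<close>.\<close>
  define m1 m2 where "m1 = (\<kappa> t1 + \<theta> s0) / 2" and "m2 = (\<theta> s1 + \<kappa> t0 + 2 * pi) / 2"
  define m d where "m = (m1 + m2) / 2" and "d = (m2 - m1) / 2"
  have m12: "m - d = m1" "m + d = m2" unfolding m_def d_def by (auto simp: field_simps)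
  have m1: "\<kappa> t1 < m1" "m1 < \<theta> s0" and m2: "\<theta> s1 < m2" "m2 < \<kappa> t0 + 2 * pi"
    unfolding m1_def m2_def using gap[of s0 t1] gap[of s1 t0] by auto
  \<comment> \<open>Four times d is (\<theta> s1 - \<kappa> t1) - (\<theta> s0 - \<kappa> t0) + 2
    pi, where the first difference is below 2 pi and the second is positive.\<close>
  have "d < pi"
    unfolding d_def m1_def m2_def using gap(2)[of s1 t1] gap(1)[of s0 t0] by (simp add: field_simps)
  have inner: "cis m \<bullet> cis x = cos (x - m)" for x
    by (simp add: inner_complex_def cos_diff)
  show ?thesis
  proof (rule that[of "cis m" "cos d"])
    fix s assume "s \<in> S"
    then have "\<bar>\<theta> s - m\<bar> < d"
      using s0[of s] s1(2)[of s] m1 m2 m12 by linarith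
    then have "cos d < cos \<bar>\<theta> s - m\<bar>"
      using \<open>d < pi\<close> by (intro cos_monotone_0_pi) auto
    then show "cos d < cis m \<bullet> a s"
      by (simp add: ab inner)
  next
    fix t assume "t \<in> T"
    then have t: "d < m - \<kappa> t" "m - \<kappa> t < 2 * pi - d"
      using t0[of t] t1(2)[of t] m1 m2 m12 by linarith+
    have "0 \<le> d"
      using s0[OF s1(1)] m1 m2 m12 by linarith
    have "cos (m - \<kappa> t) < cos d"
    proof (cases "m - \<kappa> t \<le> pi")
      case True
      then show ?thesis using t \<open>0 \<le> d\<close> by (intro cos_monotone_0_pi) auto
    next
      case False
      then have "cos (2 * pi - (m - \<kappa> t)) < cos d"
        using t \<open>0 \<le> d\<close> by (intro cos_monotone_0_pi) auto
      then show ?thesis by (simp add: cos_diff)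
    qed
    then show "cis m \<bullet> b t < cos d"
      using cos_minus[of "m - \<kappa> t"] by (simp add: ab inner)
  qed simp
qed

section \<open>Null decomposition of the differential\<close>

lemma three_eq_zero: "(3::3) = 0"
  by simp

lemma vec3_eq_iff: "x = y \<longleftrightarrow> x $ 0 = y $ 0 \<and> x $ 1 = y $ 1 \<and> x $ 2 = y $ 2" for x y :: "'a^3"
  by (simp add: vec_eq_iff forall_3 three_eq_zero) blast

lemma vec2_eq_iff: "x = y \<longleftrightarrow> x $ 1 = y $ 1 \<and> x $ 2 = y $ 2" for x y :: "'a^2"
  by (simp add: vec_eq_iff forall_2)

lemma vec2_expand: "h = (h $ 1) *\<^sub>R axis 1 1 + (h $ 2) *\<^sub>R axis 2 1" for h :: "real^2"
  by (simp add: vec2_eq_iff axis_def)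

lemma linear_vec2_expand:
  fixes f :: "real^2 \<Rightarrow> 'b::real_vector"
  assumes "linear f"
  shows "f h = (h $ 1) *\<^sub>R f (axis 1 1) + (h $ 2) *\<^sub>R f (axis 2 1)"
  by (subst vec2_expand[of h]) (simp add: linear_add[OF assms] linear_scale[OF assms])

lemma has_derivative_vec_nth:
  "(f has_derivative f') F \<Longrightarrow> ((\<lambda>x. f x $ i) has_derivative (\<lambda>h. f' h $ i)) F"
  by (rule bounded_linear.has_derivative[OF bounded_linear_vec_nth])

lemma minkowski_commute: "minkowski x y = minkowski y x"
  by (simp add: minkowski_def algebra_simps)

lemma minkowski_lincomb:
  "minkowski (a *\<^sub>R x + b *\<^sub>R y) (c *\<^sub>R x + d *\<^sub>R y) =
     a * c * minkowski x x + (a * d + b * c) * minkowski x y + b * d * minkowski y y"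
  by (simp add: minkowski_def algebra_simps)

text \<open>\<open>\<omega>1\<close>, \<open>\<omega>2\<close> are the components of the Hodge dual of the one-form with components \<open>X\<close>, \<open>Y\<close>. In
  Lorentzian signature the Hodge star on one-forms squares to the identity, and \<open>1 \<plusminus> \<star>\<close> projects
  onto the two null directions.\<close>

lemma minkowski_hodge_null:
  fixes X Y :: "real^3" and \<epsilon> a b :: real
  defines "E \<equiv> minkowski X X" and "F \<equiv> minkowski X Y" and "G \<equiv> minkowski Y Y"
  assumes W: "W\<^sup>2 = F\<^sup>2 - E * G" "W \<noteq> 0" and \<epsilon>: "\<epsilon>\<^sup>2 = 1"
  defines "\<omega>1 \<equiv> inverse W *\<^sub>R (F *\<^sub>R X - E *\<^sub>R Y)" and "\<omega>2 \<equiv> inverse W *\<^sub>R (G *\<^sub>R X - F *\<^sub>R Y)"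
  defines "Z \<equiv> a *\<^sub>R (X + \<epsilon> *\<^sub>R \<omega>1) + b *\<^sub>R (Y + \<epsilon> *\<^sub>R \<omega>2)"
  shows "minkowski Z Z = 0"
proof -
  \<comment> \<open>Z has coefficients v + \<epsilon> J v in X and Y, where v = (a, b) and J v = (a
    F + b G, - (a E + b F)) / W is the star as an operator on vectors.\<close>
  define p where "p = a + \<epsilon> * (a * F + b * G) / W"
  define q where "q = b - \<epsilon> * (a * E + b * F) / W"
  have Z: "Z = p *\<^sub>R X + q *\<^sub>R Y"
    unfolding Z_def \<omega>1_def \<omega>2_def p_def q_def using W(2)
    by (simp add: algebra_simps divide_inverse)
  have "W * p = W * a + \<epsilon> * (a * F + b * G)" "W * q = W * b - \<epsilon> * (a * E + b * F)"
    unfolding p_def q_def using W(2) by (simp_all add: field_simps)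
  then have "W\<^sup>2 * (p * p * E + 2 * p * q * F + q * q * G) =
     (W * a + \<epsilon> * (a * F + b * G))\<^sup>2 * E + 2 * (W * a + \<epsilon> * (a * F + b * G)) * (W * b - \<epsilon> * (a * E + b * F)) * F
     + (W * b - \<epsilon> * (a * E + b * F))\<^sup>2 * G"
    by (metis (no_types, opaque_lifting) distrib_left mult.assoc mult.left_commute power2_eq_square)
  \<comment> \<open>J v is orthogonal to v and has the opposite square: the mixed terms cancel, and
    the squares combine to a factor that vanishes by the choice of W and \<epsilon>.\<close>
  also have "\<dots> = (W\<^sup>2 - \<epsilon>\<^sup>2 * (F\<^sup>2 - E * G)) * (a\<^sup>2 * E + 2 * a * b * F + b\<^sup>2 * G)"
    by (simp add: power2_eq_square algebra_simps)
  also have "\<dots> = 0" using W \<epsilon> by simp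
  finally have "p * p * E + 2 * p * q * F + q * q * G = 0" using W(2) by simp
  then show ?thesis
    unfolding Z minkowski_lincomb E_def F_def G_def by (simp add: algebra_simps)
qed

lemma norm_real3: "norm (z::real^3) ^ 2 = (z $ 0)\<^sup>2 + (z $ 1)\<^sup>2 + (z $ 2)\<^sup>2"
  unfolding power2_norm_eq_inner inner_vec_def sum_3
  by (simp add: three_eq_zero power2_eq_square)

text \<open>The time component controls a null vector, which is the source of the domination by
  \<Psi>. The constant 2 is a convenient bound for the square root of 2.\<close>

lemma norm_null_vector:
  assumes "minkowski z z = 0"
  shows "norm z \<le> 2 * \<bar>z $ 0\<bar>"
proof (rule power2_le_imp_le)
  have "(norm z)\<^sup>2 = 2 * (z $ 0)\<^sup>2"
    using assms unfolding norm_real3 minkowski_def by (simp add: power2_eq_square)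
  then show "(norm z)\<^sup>2 \<le> (2 * \<bar>z $ 0\<bar>)\<^sup>2" by (simp add: power_mult_distrib)
qed simp

section \<open>Vanishing mean curvature as closedness of the Hodge dual\<close>

lemma matrix_inv_2x2:
  fixes A :: "real^2^2"
  assumes "det A \<noteq> 0"
  shows "matrix_inv A $ 1 $ 1 = A $ 2 $ 2 / det A" "matrix_inv A $ 1 $ 2 = - A $ 1 $ 2 / det A"
    "matrix_inv A $ 2 $ 1 = - A $ 2 $ 1 / det A" "matrix_inv A $ 2 $ 2 = A $ 1 $ 1 / det A"
proof -
  have "invertible A" using assms by (simp add: invertible_det_nz)
  then have "A ** matrix_inv A = mat 1" 
    unfolding invertible_def matrix_inv_def by (metis (mono_tags, lifting) someI_ex)
  then have "(A ** matrix_inv A) $ i $ j = mat 1 $ i $ j" for i j by simp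
  then have *: "A $ i $ 1 * matrix_inv A $ 1 $ j + A $ i $ 2 * matrix_inv A $ 2 $ j = (if i = j then 1 else 0)" for i j
    by (simp add: matrix_matrix_mult_def sum_2 mat_def)
  have sol: "x = (d * u - b * v) / (a * d - b * c)" "y = (a * v - c * u) / (a * d - b * c)"
    if "a * x + b * y = u" "c * x + d * y = v" "a * d - b * c \<noteq> 0" for a b c d x y u v :: real
  proof -
    have "x * (a * d - b * c) = d * u - b * v" "y * (a * d - b * c) = a * v - c * u"
      unfolding that(1,2)[symmetric] by (simp_all add: algebra_simps)
    then show "x = (d * u - b * v) / (a * d - b * c)" "y = (a * v - c * u) / (a * d - b * c)"
      using that(3) by (simp_all add: eq_divide_eq)
  qed
  show "matrix_inv A $ 1 $ 1 = A $ 2 $ 2 / det A" "matrix_inv A $ 1 $ 2 = - A $ 1 $ 2 / det A"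
    "matrix_inv A $ 2 $ 1 = - A $ 2 $ 1 / det A" "matrix_inv A $ 2 $ 2 = A $ 1 $ 1 / det A"
    using sol[OF *[of 1 1] *[of 2 1]] sol[OF *[of 1 2] *[of 2 2]] assms by (simp_all add: det_2)
qed

lemma det_induced_matrix:
  "det (induced_matrix \<phi> p) =
     minkowski (partial_deriv 1 \<phi> p) (partial_deriv 1 \<phi> p) * minkowski (partial_deriv 2 \<phi> p) (partial_deriv 2 \<phi> p)
     - (minkowski (partial_deriv 1 \<phi> p) (partial_deriv 2 \<phi> p))\<^sup>2"
  by (simp add: det_2 induced_matrix_def induced_form_def partial_deriv_def power2_eq_square minkowski_commute)

text \<open>This and \<open>hodge2\<close> are \<open>\<omega>1\<close> and \<open>\<omega>2\<close>
  of \<open>minkowski_hodge_null\<close> for the coordinate derivatives of \<open>\<phi>\<close>,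
  with W the area density.\<close>

definition hodge1 :: "(real^2 \<Rightarrow> real^3) \<Rightarrow> real^2 \<Rightarrow> real^3" where
  "hodge1 \<phi> p = inverse (area_density \<phi> p) *\<^sub>R
     (minkowski (partial_deriv 1 \<phi> p) (partial_deriv 2 \<phi> p) *\<^sub>R partial_deriv 1 \<phi> p
       - minkowski (partial_deriv 1 \<phi> p) (partial_deriv 1 \<phi> p) *\<^sub>R partial_deriv 2 \<phi> p)"

definition hodge2 :: "(real^2 \<Rightarrow> real^3) \<Rightarrow> real^2 \<Rightarrow> real^3" where
  "hodge2 \<phi> p = inverse (area_density \<phi> p) *\<^sub>R
     (minkowski (partial_deriv 2 \<phi> p) (partial_deriv 2 \<phi> p) *\<^sub>R partial_deriv 1 \<phi> p
       - minkowski (partial_deriv 1 \<phi> p) (partial_deriv 2 \<phi> p) *\<^sub>R partial_deriv 2 \<phi> p)"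

lemma partial_deriv_vec_nth:
  assumes "f differentiable (at p)"
  shows "partial_deriv i (\<lambda>x. f x $ \<alpha>) p = partial_deriv i f p $ \<alpha>"
proof -
  have "(f has_derivative frechet_derivative f (at p)) (at p)"
    using assms by (simp add: frechet_derivative_works)
  from frechet_derivative_at[OF has_derivative_vec_nth[OF this, of \<alpha>]] show ?thesis
    unfolding partial_deriv_def by metis
qed

lemma partial_deriv_minus:
  assumes "f differentiable (at p)"
  shows "partial_deriv i (\<lambda>x. - f x) p = - partial_deriv i f p"
proof -
  have "(f has_derivative frechet_derivative f (at p)) (at p)"
    using assms by (simp add: frechet_derivative_works)
  from frechet_derivative_at[OF has_derivative_minus[OF this]] show ?thesis
    unfolding partial_deriv_def by metis
qed

text \<open>As the determinant is negative, \<open>area_density\<close> divided by it is minus the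
  inverse area density. The two fluxes under the divergence are therefore \<open>- hodge2\<close>
  and \<open>hodge1\<close>, and in two dimensions a vanishing divergence is the closedness of the
  dual form.\<close>

lemma vanishing_mean_curvature_imp_closed:
  assumes "timelike \<phi>" "vanishing_mean_curvature \<phi>"
    and \<phi>: "\<And>q. \<phi> differentiable (at q)" and \<omega>: "\<And>q. hodge1 \<phi> differentiable (at q)" "\<And>q. hodge2 \<phi> differentiable (at q)"
  shows "partial_deriv 1 (hodge2 \<phi>) p = partial_deriv 2 (hodge1 \<phi>) p"
proof -
  have det: "det (induced_matrix \<phi> q) < 0" for q
    using assms(1) by (simp add: timelike_def)
  have W: "area_density \<phi> q > 0" "area_density \<phi> q * area_density \<phi> q = - det (induced_matrix \<phi> q)" for q
    using det[of q] unfolding area_density_def by simp_all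
  have W': "area_density \<phi> q / det (induced_matrix \<phi> q) = - inverse (area_density \<phi> q)" for q
    using W[of q] det[of q] by (simp add: field_simps)
  have g: "induced_matrix \<phi> q $ i $ j = minkowski (partial_deriv i \<phi> q) (partial_deriv j \<phi> q)" for q i j
    by (simp add: induced_matrix_def induced_form_def partial_deriv_def)
  have d: "det (induced_matrix \<phi> q) \<noteq> 0" for q using det[of q] by simp
  have s1: "(\<Sum>j\<in>UNIV. area_density \<phi> q * matrix_inv (induced_matrix \<phi> q) $ 1 $ j *
      partial_deriv j (\<lambda>x. \<phi> x $ \<alpha>) q) = - (hodge2 \<phi> q $ \<alpha>)" for q \<alpha>
  proof -
    have "(\<Sum>j\<in>UNIV. area_density \<phi> q * matrix_inv (induced_matrix \<phi> q) $ 1 $ j *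
      partial_deriv j (\<lambda>x. \<phi> x $ \<alpha>) q) = (area_density \<phi> q / det (induced_matrix \<phi> q)) *
      (induced_matrix \<phi> q $ 2 $ 2 * partial_deriv 1 \<phi> q $ \<alpha> - induced_matrix \<phi> q $ 1 $ 2 * partial_deriv 2 \<phi> q $ \<alpha>)"
      by (simp add: sum_2 matrix_inv_2x2[OF d] partial_deriv_vec_nth[OF \<phi>] diff_divide_distrib right_diff_distrib)
    then show ?thesis unfolding W' g hodge2_def by (simp add: algebra_simps)
  qed
  have s2: "(\<Sum>j\<in>UNIV. area_density \<phi> q * matrix_inv (induced_matrix \<phi> q) $ 2 $ j *
      partial_deriv j (\<lambda>x. \<phi> x $ \<alpha>) q) = hodge1 \<phi> q $ \<alpha>" for q \<alpha>
  proof -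
    have "(\<Sum>j\<in>UNIV. area_density \<phi> q * matrix_inv (induced_matrix \<phi> q) $ 2 $ j *
      partial_deriv j (\<lambda>x. \<phi> x $ \<alpha>) q) = (area_density \<phi> q / det (induced_matrix \<phi> q)) *
      (induced_matrix \<phi> q $ 1 $ 1 * partial_deriv 2 \<phi> q $ \<alpha> - induced_matrix \<phi> q $ 2 $ 1 * partial_deriv 1 \<phi> q $ \<alpha>)"
      by (simp add: sum_2 matrix_inv_2x2[OF d] partial_deriv_vec_nth[OF \<phi>] diff_divide_distrib right_diff_distrib)
    then show ?thesis unfolding W' g hodge1_def minkowski_commute[of "partial_deriv 2 \<phi> q" "partial_deriv 1 \<phi> q"]
      by (simp add: algebra_simps)
  qed
  have "(partial_deriv 1 (hodge2 \<phi>) p) $ \<alpha> = (partial_deriv 2 (hodge1 \<phi>) p) $ \<alpha>" for \<alpha>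
  proof -
    have "mean_curvature_vector \<phi> p $ \<alpha> = 0"
      using assms(2) by (simp add: vanishing_mean_curvature_def)
    then have "partial_deriv 1 (\<lambda>q. - (hodge2 \<phi> q $ \<alpha>)) p + partial_deriv 2 (\<lambda>q. hodge1 \<phi> q $ \<alpha>) p = 0"
      using W(1)[of p] unfolding mean_curvature_vector_def vec_lambda_beta sum_2[where f = "\<lambda>i. partial_deriv i (G i) p" for G] s1 s2
      by simp
    moreover have "(\<lambda>q. hodge2 \<phi> q $ \<alpha>) differentiable (at p)"
      using \<omega>(2)[of p] has_derivative_vec_nth unfolding differentiable_def by metis
    ultimately show ?thesis
      by (simp add: partial_deriv_minus partial_deriv_vec_nth \<omega>)
  qed
  then show ?thesis by (simp add: vec_eq_iff)
qed

section \<open>Global null coordinates\<close>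

lemma vector2_eq_axis: "(vector [x, y] :: real^2) = x *\<^sub>R axis 1 1 + y *\<^sub>R axis 2 1"
  by (simp add: vec2_eq_iff axis_def)

lemma has_derivative_vector2:
  assumes "(f has_derivative f') (at x)" "(g has_derivative g') (at x)"
  shows "((\<lambda>x. vector [f x, g x] :: real^2) has_derivative (\<lambda>h. vector [f' h, g' h])) (at x)"
  unfolding vector2_eq_axis by (intro has_derivative_add has_derivative_scaleR_left assms)

lemma continuous_on_vector2:
  assumes "continuous_on S f" "continuous_on S g"
  shows "continuous_on S (\<lambda>x. vector [f x, g x] :: real^2)"
  unfolding vector2_eq_axis by (intro continuous_intros assms)

text \<open>The difference \<open>d x\<close> of the solutions at x and x0 is mapped by f' x to
  \<open>k - f' x (inv (f' x0) k)\<close>, which tends to 0; the lower bound of f' near x0 then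
  forces \<open>d x\<close> to 0.\<close>

lemma continuous_on_inv_linear:
  fixes f' :: "'a::euclidean_space \<Rightarrow> 'b::euclidean_space \<Rightarrow> 'b"
  assumes lin: "\<And>x. linear (f' x)" and cont: "\<And>v. continuous_on UNIV (\<lambda>x. f' x v)"
    and inj: "\<And>x. inj (f' x)"
  shows "continuous_on UNIV (\<lambda>x. inv (f' x) k)"
proof -
  have inv: "f' x (inv (f' x) k) = k" for x k
    using linear_inj_imp_surj[OF lin inj] by (simp add: surj_f_inv_f)
  have "isCont (\<lambda>x. inv (f' x) k) x0" for x0
  proof -
    obtain m where m: "m > 0" "\<And>x h. x \<in> cball x0 1 \<Longrightarrow> m * norm h \<le> norm (f' x h)"
      using injective_derivative_bounded_below[OF lin cont inj compact_cball] by metis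
    define d where "d x = inv (f' x) k - inv (f' x0) k" for x
    have fd: "f' x (d x) = k - f' x (inv (f' x0) k)" for x
      unfolding d_def by (simp add: linear_diff[OF lin] inv)
    have "isCont (\<lambda>x. f' x (inv (f' x0) k)) x0"
      using cont[of "inv (f' x0) k"] by (simp add: continuous_on_eq_continuous_at)
    then have "((\<lambda>x. k - f' x (inv (f' x0) k)) \<longlongrightarrow> k - f' x0 (inv (f' x0) k)) (at x0)"
      unfolding isCont_def by (intro tendsto_intros)
    then have "((\<lambda>x. (1 / m) * norm (k - f' x (inv (f' x0) k))) \<longlongrightarrow> (1 / m) * norm (k - f' x0 (inv (f' x0) k))) (at x0)"
      by (intro tendsto_mult_left tendsto_norm)
    then have lim: "((\<lambda>x. (1 / m) * norm (k - f' x (inv (f' x0) k))) \<longlongrightarrow> 0) (at x0)"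
      by (simp only: inv diff_self norm_zero mult_zero_right)
    have "eventually (\<lambda>x. x \<in> cball x0 1) (at x0)"
      by (rule eventually_at_in_open'[of "ball x0 1", THEN eventually_mono]) auto
    then have "eventually (\<lambda>x. norm (d x) \<le> (1 / m) * norm (k - f' x (inv (f' x0) k))) (at x0)"
    proof (rule eventually_mono)
      fix x assume "x \<in> cball x0 1"
      from m(2)[OF this, of "d x"] show "norm (d x) \<le> (1 / m) * norm (k - f' x (inv (f' x0) k))"
        unfolding fd using m(1) by (simp add: field_simps)
    qed
    then have "(d \<longlongrightarrow> 0) (at x0)" by (rule Lim_null_comparison[OF _ lim])
    then show ?thesis unfolding isCont_def d_def by (subst LIM_zero_iff[symmetric]) simp
  qed
  then show ?thesis by (simp add: continuous_on_eq_continuous_at)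
qed

lemma zero_vector_derivative_imp_constant:
  fixes f :: "real \<Rightarrow> 'b::real_normed_vector"
  assumes "\<And>t. (f has_vector_derivative 0) (at t)"
  shows "f s = f t"
  using has_vector_derivative_zero_constant[of UNIV f] assms by (metis UNIV_I convex_UNIV)

text \<open>The time components of \<open>A\<close> and \<open>B\<close> serve as null coordinates: a null vector without time
  component vanishes, so \<open>A\<close> is constant where its time component is.\<close>

lemma null_splitting_coordinates:
  fixes A B :: "real^2 \<Rightarrow> real^3"
  assumes A: "\<And>p. (A has_derivative A' p) (at p)" and contA: "\<And>h. continuous_on UNIV (\<lambda>p. A' p h)"
    and nullA: "\<And>p h. minkowski (A' p h) (A' p h) = 0"
    and B: "\<And>p. (B has_derivative B' p) (at p)" and contB: "\<And>h. continuous_on UNIV (\<lambda>p. B' p h)"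
    and nullB: "\<And>p h. minkowski (B' p h) (B' p h) = 0"
    and inj: "\<And>p. inj (\<lambda>h. A' p h + B' p h)"
    and proper: "proper_map euclidean euclidean (\<lambda>p. A p + B p)"
  obtains \<alpha> \<beta> \<alpha>' \<beta>' where
    "\<And>p. A p = \<alpha> (A p $ 0)" "\<And>p. B p = \<beta> (B p $ 0)"
    "\<And>p q. A p $ 0 = A q $ 0 \<Longrightarrow> B p $ 0 = B q $ 0 \<Longrightarrow> p = q"
    "\<And>s. (\<alpha> has_vector_derivative \<alpha>' s) (at s)" "continuous_on UNIV \<alpha>'"
    "\<And>s. \<alpha>' s $ 0 = 1" "\<And>s. minkowski (\<alpha>' s) (\<alpha>' s) = 0"
    "\<And>s. (\<beta> has_vector_derivative \<beta>' s) (at s)" "continuous_on UNIV \<beta>'"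
    "\<And>s. \<beta>' s $ 0 = 1" "\<And>s. minkowski (\<beta>' s) (\<beta>' s) = 0"
    "\<And>s t. \<alpha>' s \<noteq> \<beta>' t"
proof -
  define \<Psi> :: "real^2 \<Rightarrow> real^2" where "\<Psi> p = vector [A p $ 0, B p $ 0]" for p
  define \<Psi>' :: "real^2 \<Rightarrow> real^2 \<Rightarrow> real^2" where "\<Psi>' p h = vector [A' p h $ 0, B' p h $ 0]" for p h
  have linA: "linear (A' p)" and linB: "linear (B' p)" for p
    using A B by (auto intro: has_derivative_linear)
  have \<Psi>: "(\<Psi> has_derivative \<Psi>' p) (at p)" for p
    unfolding \<Psi>_def \<Psi>'_def by (intro has_derivative_vector2 has_derivative_vec_nth A B)
  have lin\<Psi>: "linear (\<Psi>' p)" for p by (rule has_derivative_linear[OF \<Psi>])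
  have cont\<Psi>: "continuous_on UNIV (\<lambda>p. \<Psi>' p h)" for h
    unfolding \<Psi>'_def by (intro continuous_on_vector2 continuous_intros contA contB)
  \<comment> \<open>Each null vector is bounded by twice its time component, and the two time
    components are the components of \<Psi>'; hence 4 = 2 + 2.\<close>
  have le: "norm (A' p h + B' p h) \<le> 4 * norm (\<Psi>' p h)" for p h
  proof -
    have "norm (A' p h + B' p h) \<le> 2 * \<bar>A' p h $ 0\<bar> + 2 * \<bar>B' p h $ 0\<bar>"
      using norm_triangle_ineq[of "A' p h" "B' p h"] norm_null_vector[OF nullA] norm_null_vector[OF nullB]
      by (meson add_mono order_trans)
    also have "\<dots> \<le> 2 * norm (\<Psi>' p h) + 2 * norm (\<Psi>' p h)"
      using component_le_norm_cart[of "\<Psi>' p h" 1] component_le_norm_cart[of "\<Psi>' p h" 2]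
      unfolding \<Psi>'_def by simp
    finally show ?thesis by simp
  qed
  have inj\<Psi>: "inj (\<Psi>' p)" for p
  proof (rule iffD2[OF linear_injective_0[OF lin\<Psi>]], intro allI impI)
    fix h assume "\<Psi>' p h = 0"
    then have "A' p h + B' p h = 0" using le[of p h] by simp
    moreover have "A' p 0 + B' p 0 = 0" using linear_0[OF linA] linear_0[OF linB] by simp
    ultimately show "h = 0" using injD[OF inj[of p], of h 0] by simp
  qed
  obtain \<sigma> where \<sigma>: "\<And>y. \<Psi> (\<sigma> y) = y" "\<And>p. \<sigma> (\<Psi> p) = p" "\<And>y. (\<sigma> has_derivative inv (\<Psi>' (\<sigma> y))) (at y)"
    by (rule bijective_of_dominated_proper_map[OF \<Psi> cont\<Psi> inj\<Psi> has_derivative_add[OF A B] le proper]) (rule that)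
  define N where "N y k = A' (\<sigma> y) (inv (\<Psi>' (\<sigma> y)) k)" for y k
  define M where "M y k = B' (\<sigma> y) (inv (\<Psi>' (\<sigma> y)) k)" for y k
  have A\<sigma>: "((\<lambda>y. A (\<sigma> y)) has_derivative N y) (at y)" for y
    unfolding N_def by (rule has_derivative_compose[OF \<sigma>(3) A])
  have B\<sigma>: "((\<lambda>y. B (\<sigma> y)) has_derivative M y) (at y)" for y
    unfolding M_def by (rule has_derivative_compose[OF \<sigma>(3) B])
  have inv: "\<Psi>' p (inv (\<Psi>' p) k) = k" for p k
    using linear_inj_imp_surj[OF lin\<Psi> inj\<Psi>] by (simp add: surj_f_inv_f)
  have N0: "N y k $ 0 = k $ 1" and M0: "M y k $ 0 = k $ 2" for y k
    using inv[of "\<sigma> y" k] unfolding N_def M_def \<Psi>'_def by (simp_all add: vec2_eq_iff)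
  have nullN: "minkowski (N y k) (N y k) = 0" and nullM: "minkowski (M y k) (M y k) = 0" for y k
    unfolding N_def M_def by (rule nullA nullB)+
  have N_zero: "N y k = 0" if "k $ 1 = 0" for y k
    using norm_null_vector[OF nullN, of y k] that by (simp add: N0)
  have M_zero: "M y k = 0" if "k $ 2 = 0" for y k
    using norm_null_vector[OF nullM, of y k] that by (simp add: M0)
  \<comment> \<open>One family of affine lines serves twice: the axes give the curves \<alpha> and
    \<beta>, the other coordinate lines show that A and B depend on one coordinate each.\<close>
  have line: "((\<lambda>t. vector [a + c * t, b + d * t] :: real^2) has_derivative (\<lambda>h. vector [c * h, d * h])) (at t)"
    for a b c d t :: real
    by (rule has_derivative_vector2) (auto intro!: derivative_eq_intros)
  have lineA: "((\<lambda>t. A (\<sigma> (vector [a + c * t, b + d * t]))) has_vector_derivative N (vector [a + c * t, b + d * t]) (vector [c, d])) (at t)"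
    for a b c d t
  proof -
    have "vector [c * h, d * h] = h *\<^sub>R (vector [c, d] :: real^2)" for h by (simp add: vec2_eq_iff)
    then have "N y (vector [c * h, d * h]) = h *\<^sub>R N y (vector [c, d])" for y h
      by (simp add: linear_scale[OF has_derivative_linear[OF A\<sigma>]])
    then show ?thesis
      using has_derivative_compose[OF line[of a c b d t] A\<sigma>]
      by (simp only: has_vector_derivative_def)
  qed
  have lineB: "((\<lambda>t. B (\<sigma> (vector [a + c * t, b + d * t]))) has_vector_derivative M (vector [a + c * t, b + d * t]) (vector [c, d])) (at t)"
    for a b c d t
  proof -
    have "vector [c * h, d * h] = h *\<^sub>R (vector [c, d] :: real^2)" for h by (simp add: vec2_eq_iff)
    then have "M y (vector [c * h, d * h]) = h *\<^sub>R M y (vector [c, d])" for y h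
      by (simp add: linear_scale[OF has_derivative_linear[OF B\<sigma>]])
    then show ?thesis
      using has_derivative_compose[OF line[of a c b d t] B\<sigma>]
      by (simp only: has_vector_derivative_def)
  qed
  define \<alpha> where "\<alpha> s = A (\<sigma> (vector [s, 0]))" for s
  define \<beta> where "\<beta> t = B (\<sigma> (vector [0, t]))" for t
  define \<alpha>' where "\<alpha>' s = N (vector [s, 0]) (vector [1, 0])" for s
  define \<beta>' where "\<beta>' t = M (vector [0, t]) (vector [0, 1])" for t
  have \<alpha>: "A (\<sigma> (vector [s, t])) = \<alpha> s" for s t
    using zero_vector_derivative_imp_constant[of "\<lambda>t. A (\<sigma> (vector [s, t]))" t 0] lineA[of s 0 0 1] N_zero
    unfolding \<alpha>_def by simp
  have \<beta>: "B (\<sigma> (vector [s, t])) = \<beta> t" for s t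
    using zero_vector_derivative_imp_constant[of "\<lambda>s. B (\<sigma> (vector [s, t]))" s 0] lineB[of 0 1 t 0] M_zero
    unfolding \<beta>_def by simp
  have \<alpha>d: "(\<alpha> has_vector_derivative \<alpha>' s) (at s)" and \<beta>d: "(\<beta> has_vector_derivative \<beta>' s) (at s)" for s
    using lineA[of 0 1 0 0 s] lineB[of 0 0 0 1 s] unfolding \<alpha>_def \<beta>_def \<alpha>'_def \<beta>'_def by simp_all
  have ne: "\<alpha>' s \<noteq> \<beta>' t" for s t
  proof
    assume eq: "\<alpha>' s = \<beta>' t"
    \<comment> \<open>In the direction (1, -1) the differential of A + B at (s, t) is \<alpha>' s -
      \<beta>' t; if this vanished, the map would not be an immersion there.\<close>
    let ?y = "vector [s, t] :: real^2" and ?k = "vector [1, -1] :: real^2"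
    have "(\<alpha> has_vector_derivative N ?y (vector [1, 0])) (at s)"
      using lineA[of 0 1 t 0 s] by (simp add: \<alpha>)
    then have N: "N ?y (vector [1, 0]) = \<alpha>' s"
      using vector_derivative_unique_at[OF \<alpha>d] by metis
    have "(\<beta> has_vector_derivative M ?y (vector [0, 1])) (at t)"
      using lineB[of s 0 0 1 t] by (simp add: \<beta>)
    then have M: "M ?y (vector [0, 1]) = \<beta>' t"
      using vector_derivative_unique_at[OF \<beta>d] by metis
    have k: "?k = vector [1, 0] - vector [0, 1]" by (simp add: vec2_eq_iff)
    have "N ?y ?k = \<alpha>' s"
      unfolding k linear_diff[OF has_derivative_linear[OF A\<sigma>]] N using N_zero[of "vector [0,1]"] by simp
    moreover have "M ?y ?k = - \<beta>' t"
      unfolding k linear_diff[OF has_derivative_linear[OF B\<sigma>]] M using M_zero[of "vector [1,0]"] by simp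
    ultimately have "N ?y ?k + M ?y ?k = 0" using eq by simp
    moreover have "A' (\<sigma> ?y) 0 + B' (\<sigma> ?y) 0 = 0" using linear_0[OF linA] linear_0[OF linB] by simp
    ultimately have "inv (\<Psi>' (\<sigma> ?y)) ?k = 0"
      using injD[OF inj[of "\<sigma> ?y"], of "inv (\<Psi>' (\<sigma> ?y)) ?k" 0] unfolding N_def M_def by simp
    then have "?k = 0" using inv[of "\<sigma> ?y" ?k] linear_0[OF lin\<Psi>] by simp
    then show False by (simp add: vec2_eq_iff)
  qed
  have cont\<sigma>: "continuous_on UNIV \<sigma>"
    by (intro continuous_at_imp_continuous_on ballI has_derivative_continuous[OF \<sigma>(3)])
  have continv: "continuous_on UNIV (\<lambda>y. inv (\<Psi>' (\<sigma> y)) k)" for k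
    by (rule continuous_on_compose2[OF continuous_on_inv_linear[OF lin\<Psi> cont\<Psi> inj\<Psi>] cont\<sigma>]) simp
  have contN: "continuous_on UNIV (\<lambda>y. N y k)" and contM: "continuous_on UNIV (\<lambda>y. M y k)" for k
    unfolding N_def M_def linear_vec2_expand[OF linA, of _ "inv _ _"] linear_vec2_expand[OF linB, of _ "inv _ _"]
    by (intro continuous_intros continv continuous_on_compose2[OF contA cont\<sigma>] continuous_on_compose2[OF contB cont\<sigma>] subset_UNIV)+
  show ?thesis
  proof (rule that[of \<alpha> \<beta> \<alpha>' \<beta>'])
    show "A p = \<alpha> (A p $ 0)" "B p = \<beta> (B p $ 0)" for p
      using \<alpha>[of "A p $ 0" "B p $ 0"] \<beta>[of "A p $ 0" "B p $ 0"] \<sigma>(2)[of p] unfolding \<Psi>_def by simp_all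
    show "p = q" if "A p $ 0 = A q $ 0" "B p $ 0 = B q $ 0" for p q
    proof -
      have "\<Psi> p = \<Psi> q" unfolding \<Psi>_def that ..
      then show ?thesis using \<sigma>(2) by metis
    qed
    show "continuous_on UNIV \<alpha>'" "continuous_on UNIV \<beta>'"
      unfolding \<alpha>'_def \<beta>'_def
      by (rule continuous_on_compose2[OF contN] continuous_on_compose2[OF contM],
          intro continuous_on_vector2 continuous_intros, simp)+
    show "\<alpha>' s $ 0 = 1" "\<beta>' s $ 0 = 1" for s
      unfolding \<alpha>'_def \<beta>'_def by (simp_all add: N0 M0)
    show "minkowski (\<alpha>' s) (\<alpha>' s) = 0" "minkowski (\<beta>' s) (\<beta>' s) = 0" for s
      unfolding \<alpha>'_def \<beta>'_def by (rule nullN nullM)+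
  qed (fact \<alpha>d \<beta>d ne)+
qed

section \<open>Null coordinates of a minimal surface\<close>

lemma Ck_on_minkowski:
  assumes "open S" "Ck_on k S f" "Ck_on k S g"
  shows "Ck_on k S (\<lambda>x. minkowski (f x) (g x))"
  unfolding minkowski_def
  by (intro Ck_on_add Ck_on_minus Ck_on_mult Ck_on_bounded_linear[OF _ bounded_linear_vec_nth] assms)

lemma Ck_on_hodge:
  assumes "smooth_on UNIV \<phi>" "timelike \<phi>"
  shows "Ck_on k UNIV (partial_deriv i \<phi>)" "Ck_on k UNIV (hodge1 \<phi>)" "Ck_on k UNIV (hodge2 \<phi>)"
proof -
  have pd: "Ck_on k UNIV (partial_deriv i \<phi>)" for i
    using assms(1)[unfolded smooth_on_def, rule_format, of "Suc k"] unfolding partial_deriv_def[abs_def] by simp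
  have det: "det (induced_matrix \<phi> p) < 0" for p
    using assms(2) by (simp add: timelike_def)
  have W: "area_density \<phi> p > 0" for p
    using det[of p] unfolding area_density_def by simp
  have "Ck_on k UNIV (\<lambda>p. sqrt (- det (induced_matrix \<phi> p)))"
  proof (rule Ck_on_sqrt)
    show "Ck_on k UNIV (\<lambda>p. - det (induced_matrix \<phi> p))"
      unfolding det_induced_matrix power2_eq_square
      by (intro Ck_on_minus Ck_on_diff Ck_on_mult Ck_on_minkowski pd open_UNIV)
  qed (use det in simp_all)
  moreover have "area_density \<phi> = (\<lambda>p. sqrt (- det (induced_matrix \<phi> p)))"
    unfolding area_density_def using det by (simp add: abs_of_neg fun_eq_iff)
  ultimately have "Ck_on k UNIV (area_density \<phi>)" by simp
  then have "Ck_on k UNIV (\<lambda>p. inverse (area_density \<phi> p))"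
    by (rule Ck_on_inverse[OF open_UNIV]) (metis W less_irrefl)
  then show "Ck_on k UNIV (partial_deriv i \<phi>)" "Ck_on k UNIV (hodge1 \<phi>)" "Ck_on k UNIV (hodge2 \<phi>)"
    unfolding hodge1_def[abs_def] hodge2_def[abs_def]
    by (intro Ck_on_scaleR Ck_on_diff Ck_on_minkowski pd open_UNIV | assumption)+
qed

lemma hodge_dual_primitive:
  assumes "smooth_on UNIV \<phi>" "timelike \<phi>" "vanishing_mean_curvature \<phi>"
  obtains \<psi> where "\<And>p. (\<psi> has_derivative (\<lambda>h. (h $ 1) *\<^sub>R hodge1 \<phi> p + (h $ 2) *\<^sub>R hodge2 \<phi> p)) (at p)"
proof -
  note Ck = Ck_on_hodge[OF assms(1,2)]
  let ?D1 = "\<lambda>p. frechet_derivative (hodge1 \<phi>) (at p)" and ?D2 = "\<lambda>p. frechet_derivative (hodge2 \<phi>) (at p)"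
  have d: "\<phi> differentiable (at p)" "hodge1 \<phi> differentiable (at p)" "hodge2 \<phi> differentiable (at p)" for p
    using assms(1)[unfolded smooth_on_def, rule_format, of 1] Ck(2,3)[of 1] by simp_all
  have D1: "(hodge1 \<phi> has_derivative ?D1 p) (at p)" and D2: "(hodge2 \<phi> has_derivative ?D2 p) (at p)" for p
    using d by (simp_all add: frechet_derivative_works)
  have c: "continuous_on UNIV (\<lambda>p. ?D1 p h)" "continuous_on UNIV (\<lambda>p. ?D2 p h)" for h
    using Ck(2,3)[of "Suc 0"] by simp_all
  have closed: "?D2 p (axis 1 1) = ?D1 p (axis 2 1)" for p
    using vanishing_mean_curvature_imp_closed[OF assms(2,3) d, of p] unfolding partial_deriv_def .
  show ?thesis
  proof (rule closed_form_has_primitive[of "\<lambda>p h. (h $ 1) *\<^sub>R hodge1 \<phi> p + (h $ 2) *\<^sub>R hodge2 \<phi> p"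
        "\<lambda>p h k. (k $ 1) *\<^sub>R ?D1 p h + (k $ 2) *\<^sub>R ?D2 p h"])
    show "linear (\<lambda>h. (h $ 1) *\<^sub>R hodge1 \<phi> p + (h $ 2) *\<^sub>R hodge2 \<phi> p)" for p
      by (rule linearI) (simp_all add: algebra_simps)
    show "((\<lambda>x. (k $ 1) *\<^sub>R hodge1 \<phi> x + (k $ 2) *\<^sub>R hodge2 \<phi> x) has_derivative
        (\<lambda>h. (k $ 1) *\<^sub>R ?D1 x h + (k $ 2) *\<^sub>R ?D2 x h)) (at x)" for x k
      by (intro has_derivative_add has_derivative_scaleR_right D1 D2)
    show "continuous_on UNIV (\<lambda>x. (k $ 1) *\<^sub>R ?D1 x h + (k $ 2) *\<^sub>R ?D2 x h)" for h k
      by (intro continuous_intros c)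
    \<comment> \<open>After expanding h and k in the basis, the diagonal terms are symmetric by
      themselves and the mixed ones agree by \<open>closed\<close>.\<close>
    show "(k $ 1) *\<^sub>R ?D1 x h + (k $ 2) *\<^sub>R ?D2 x h = (h $ 1) *\<^sub>R ?D1 x k + (h $ 2) *\<^sub>R ?D2 x k" for x h k
      unfolding linear_vec2_expand[OF has_derivative_linear[OF D1], of x h] linear_vec2_expand[OF has_derivative_linear[OF D2], of x h]
        linear_vec2_expand[OF has_derivative_linear[OF D1], of x k] linear_vec2_expand[OF has_derivative_linear[OF D2], of x k] closed
      by (simp add: algebra_simps)
  qed (rule that)
qed

lemma minimal_surface_null_coordinates:
  assumes "smooth_immersion \<phi>" "proper_map euclidean euclidean \<phi>" "timelike \<phi>" "vanishing_mean_curvature \<phi>"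
  obtains u v u' v' \<alpha> \<beta> \<alpha>' \<beta>' where
    "\<And>p. \<phi> p = \<alpha> (u p) + \<beta> (v p)"
    "\<And>p. (u has_derivative u' p) (at p)" "\<And>p. (v has_derivative v' p) (at p)"
    "\<And>p q. u p = u q \<Longrightarrow> v p = v q \<Longrightarrow> p = q"
    "\<And>s. (\<alpha> has_vector_derivative \<alpha>' s) (at s)" "continuous_on UNIV \<alpha>'"
    "\<And>s. \<alpha>' s $ 0 = 1" "\<And>s. minkowski (\<alpha>' s) (\<alpha>' s) = 0"
    "\<And>s. (\<beta> has_vector_derivative \<beta>' s) (at s)" "continuous_on UNIV \<beta>'"
    "\<And>s. \<beta>' s $ 0 = 1" "\<And>s. minkowski (\<beta>' s) (\<beta>' s) = 0"
    "\<And>s t. \<alpha>' s \<noteq> \<beta>' t"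
proof -
  have smooth: "smooth_on UNIV \<phi>" and inj: "inj (frechet_derivative \<phi> (at p))" for p
    using assms(1) unfolding smooth_immersion_def by auto
  note Ck = Ck_on_hodge[OF smooth assms(3)]
  obtain \<psi> where \<psi>: "\<And>p. (\<psi> has_derivative (\<lambda>h. (h $ 1) *\<^sub>R hodge1 \<phi> p + (h $ 2) *\<^sub>R hodge2 \<phi> p)) (at p)"
    by (rule hodge_dual_primitive[OF smooth assms(3,4)]) (rule that)
  have \<phi>: "(\<phi> has_derivative frechet_derivative \<phi> (at p)) (at p)" for p
    using smooth[unfolded smooth_on_def, rule_format, of "Suc 0"] by (simp add: frechet_derivative_works)
  have \<phi>': "frechet_derivative \<phi> (at p) h = (h $ 1) *\<^sub>R partial_deriv 1 \<phi> p + (h $ 2) *\<^sub>R partial_deriv 2 \<phi> p" for p h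
    unfolding partial_deriv_def by (rule linear_vec2_expand[OF has_derivative_linear[OF \<phi>]])
  \<comment> \<open>\<epsilon> = 1 and \<epsilon> = -1 give the maps A and B of the overview, so
    differentiability and nullity are proved once for both.\<close>
  define C where "C \<epsilon> p = (1/2) *\<^sub>R (\<phi> p + \<epsilon> *\<^sub>R \<psi> p)" for \<epsilon> p
  define C' where "C' \<epsilon> p h = (h $ 1 / 2) *\<^sub>R (partial_deriv 1 \<phi> p + \<epsilon> *\<^sub>R hodge1 \<phi> p) +
     (h $ 2 / 2) *\<^sub>R (partial_deriv 2 \<phi> p + \<epsilon> *\<^sub>R hodge2 \<phi> p)" for \<epsilon> p and h :: "real^2"
  have C: "(C \<epsilon> has_derivative C' \<epsilon> p) (at p)" for \<epsilon> p
  proof -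
    have "(C \<epsilon> has_derivative (\<lambda>h. (1/2) *\<^sub>R (frechet_derivative \<phi> (at p) h +
        \<epsilon> *\<^sub>R ((h $ 1) *\<^sub>R hodge1 \<phi> p + (h $ 2) *\<^sub>R hodge2 \<phi> p)))) (at p)"
      unfolding C_def[abs_def] by (intro has_derivative_scaleR_right has_derivative_add \<phi> \<psi>)
    moreover have "(1/2) *\<^sub>R (frechet_derivative \<phi> (at p) h +
        \<epsilon> *\<^sub>R ((h $ 1) *\<^sub>R hodge1 \<phi> p + (h $ 2) *\<^sub>R hodge2 \<phi> p)) = C' \<epsilon> p h" for h
      unfolding C'_def \<phi>' by (simp add: algebra_simps)
    ultimately show ?thesis by simp
  qed
  have cont: "continuous_on UNIV (\<lambda>p. C' \<epsilon> p h)" for \<epsilon> h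
    unfolding C'_def by (intro continuous_intros Ck_on_continuous[OF Ck(1)] Ck_on_continuous[OF Ck(2)] Ck_on_continuous[OF Ck(3)])
  have det: "det (induced_matrix \<phi> p) < 0" for p
    using assms(3) by (simp add: timelike_def)
  have null: "minkowski (C' \<epsilon> p h) (C' \<epsilon> p h) = 0" if "\<epsilon>\<^sup>2 = 1" for \<epsilon> p h
    unfolding C'_def hodge1_def hodge2_def
  proof (rule minkowski_hodge_null[OF _ _ that])
    show "(area_density \<phi> p)\<^sup>2 = (minkowski (partial_deriv 1 \<phi> p) (partial_deriv 2 \<phi> p))\<^sup>2
       - minkowski (partial_deriv 1 \<phi> p) (partial_deriv 1 \<phi> p) * minkowski (partial_deriv 2 \<phi> p) (partial_deriv 2 \<phi> p)"
      using det[of p] unfolding area_density_def by (simp add: det_induced_matrix)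
    show "area_density \<phi> p \<noteq> 0" using det[of p] unfolding area_density_def by simp
  qed
  have sum: "C 1 p + C (-1) p = \<phi> p" for p
    unfolding C_def by (simp add: scaleR_right_distrib[symmetric] scaleR_2[symmetric])
  have sum': "C' 1 p h + C' (-1) p h = frechet_derivative \<phi> (at p) h" for p h
  proof -
    have "(\<phi> has_derivative (\<lambda>h. C' 1 p h + C' (-1) p h)) (at p)"
      using has_derivative_add[OF C[of 1 p] C[of "-1" p]] by (simp only: sum)
    from has_derivative_unique[OF this \<phi>] show ?thesis by metis
  qed
  obtain \<alpha> \<beta> \<alpha>' \<beta>' where *: "\<And>p. C 1 p = \<alpha> (C 1 p $ 0)" "\<And>p. C (-1) p = \<beta> (C (-1) p $ 0)"
    "\<And>p q. C 1 p $ 0 = C 1 q $ 0 \<Longrightarrow> C (-1) p $ 0 = C (-1) q $ 0 \<Longrightarrow> p = q"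
    "\<And>s. (\<alpha> has_vector_derivative \<alpha>' s) (at s)" "continuous_on UNIV \<alpha>'"
    "\<And>s. \<alpha>' s $ 0 = 1" "\<And>s. minkowski (\<alpha>' s) (\<alpha>' s) = 0"
    "\<And>s. (\<beta> has_vector_derivative \<beta>' s) (at s)" "continuous_on UNIV \<beta>'"
    "\<And>s. \<beta>' s $ 0 = 1" "\<And>s. minkowski (\<beta>' s) (\<beta>' s) = 0"
    "\<And>s t. \<alpha>' s \<noteq> \<beta>' t"
    by (rule null_splitting_coordinates[of "C 1" "C' 1" "C (-1)" "C' (-1)", OF C cont null C cont null, unfolded sum sum',
          OF _ _ inj assms(2)]) (simp, simp, rule that)
  show ?thesis
  proof (rule that[of \<alpha> "\<lambda>p. C 1 p $ 0" \<beta> "\<lambda>p. C (-1) p $ 0"])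
    show "\<phi> p = \<alpha> (C 1 p $ 0) + \<beta> (C (-1) p $ 0)" for p
      using sum[of p] *(1,2)[of p] by simp
    show "((\<lambda>p. C 1 p $ 0) has_derivative (\<lambda>h. C' 1 p h $ 0)) (at p)"
      "((\<lambda>p. C (-1) p $ 0) has_derivative (\<lambda>h. C' (-1) p h $ 0)) (at p)" for p
      by (intro has_derivative_vec_nth C)+
    show "p = q" if "C 1 p $ 0 = C 1 q $ 0" "C (-1) p $ 0 = C (-1) q $ 0" for p q
      by (rule *(3)[OF that])
  qed (fact *)+
qed

section \<open>Smoothness of inverse maps in the plane\<close>

lemma inv_linear_vec2:
  fixes M :: "real^2 \<Rightarrow> real^2"
  assumes "linear M" "inj M"
  defines "a \<equiv> M (axis 1 1) $ 1" and "c \<equiv> M (axis 1 1) $ 2" and "b \<equiv> M (axis 2 1) $ 1" and "d \<equiv> M (axis 2 1) $ 2"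
  shows "a * d - b * c \<noteq> 0"
    and "inv M k = vector [inverse (a * d - b * c) * (d * k $ 1 - b * k $ 2), inverse (a * d - b * c) * (a * k $ 2 - c * k $ 1)]"
proof -
  have "M (inv M k) = k" for k
    using linear_inj_imp_surj[OF assms(1,2)] by (simp add: surj_f_inv_f)
  then have "a * inv M k $ 1 + b * inv M k $ 2 = k $ 1" "c * inv M k $ 1 + d * inv M k $ 2 = k $ 2" for k
    using linear_vec2_expand[OF assms(1), of "inv M k"] unfolding a_def b_def c_def d_def
    by (simp_all add: vec2_eq_iff mult.commute)
  note eq = this
  define p q r s where "p = inv M (axis 1 1) $ 1" and "q = inv M (axis 1 1) $ 2"
    and "r = inv M (axis 2 1) $ 1" and "s = inv M (axis 2 1) $ 2"
  have e: "a * p + b * q = 1" "c * p + d * q = 0" "a * r + b * s = 0" "c * r + d * s = 1"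
    using eq[of "axis 1 1"] eq[of "axis 2 1"] unfolding p_def q_def r_def s_def by (simp_all add: axis_def)
  have "(a * d - b * c) * (p * s - q * r) = (a * p + b * q) * (c * r + d * s) - (a * r + b * s) * (c * p + d * q)"
    by (simp add: algebra_simps)
  also have "\<dots> = 1" unfolding e by simp
  finally show det: "a * d - b * c \<noteq> 0" by auto
  have "(a * d - b * c) * inv M k $ 1 = d * k $ 1 - b * k $ 2" "(a * d - b * c) * inv M k $ 2 = a * k $ 2 - c * k $ 1"
    unfolding eq[of k, symmetric] by (simp_all add: algebra_simps)
  then have "inv M k $ 1 = inverse (a * d - b * c) * (d * k $ 1 - b * k $ 2)"
    "inv M k $ 2 = inverse (a * d - b * c) * (a * k $ 2 - c * k $ 1)"
    using det by (metis mult.assoc left_inverse mult_1)+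
  then show "inv M k = vector [inverse (a * d - b * c) * (d * k $ 1 - b * k $ 2), inverse (a * d - b * c) * (a * k $ 2 - c * k $ 1)]"
    by (simp add: vec2_eq_iff)
qed

text \<open>Bootstrapping: the derivative of the inverse g at y is the inverse of f' at g y, and
  Cramer's rule makes it rational in entries composed with g. So if g is C^k, its derivative is C^k.
  Invariance of domain starts the induction.\<close>

lemma smooth_on_inv_into:
  fixes f :: "real^2 \<Rightarrow> real^2"
  assumes "open W" and smooth: "smooth_on W f" and "inj_on f W"
    and inj: "\<And>x. x \<in> W \<Longrightarrow> inj (frechet_derivative f (at x))"
  shows "open (f ` W)" "smooth_on (f ` W) (inv_into W f)"
proof -
  let ?g = "inv_into W f" and ?f' = "\<lambda>x. frechet_derivative f (at x)"
  have Ck: "Ck_on k W f" for k using smooth unfolding smooth_on_def by blast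
  have cf: "continuous_on W f" by (rule Ck_on_continuous[OF Ck])
  show op: "open (f ` W)" by (rule invariance_of_domain[OF cf assms(1,3)])
  have cg: "continuous_on (f ` W) ?g"
    by (rule continuous_on_inverse_open[OF assms(1) cf]) (use assms(3) in simp_all)
  have gW: "?g y \<in> W" if "y \<in> f ` W" for y using that by (rule inv_into_into)
  have f': "(f has_derivative ?f' x) (at x)" if "x \<in> W" for x
    by (rule Ck_on_Suc_has_derivative[OF Ck that])
  have g': "(?g has_derivative inv (?f' (?g y))) (at y)" if "y \<in> f ` W" for y
    by (rule has_derivative_section[OF f'[OF gW[OF that]] inj[OF gW[OF that]] op that cg])
      (rule f_inv_into_f)
  have "Ck_on k (f ` W) ?g" for k
  proof (induction k)
    case 0
    show ?case using cg by simp
  next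
    case (Suc k)
    let ?m = "\<lambda>i j x. ?f' x (axis j 1) $ i"
    let ?det = "\<lambda>x. ?m 1 1 x * ?m 2 2 x - ?m 1 2 x * ?m 2 1 x"
    have m: "Ck_on k (f ` W) (\<lambda>y. ?m i j (?g y))" for i j
    proof (rule Ck_on_compose[OF op Suc.IH])
      show "Ck_on k W (?m i j)"
        using Ck[of "Suc k"] by (intro Ck_on_bounded_linear[OF assms(1) bounded_linear_vec_nth]) simp
    qed (use gW in blast)
    have G: "inv (?f' (?g y)) v = (inverse (?det (?g y)) * (?m 2 2 (?g y) * v $ 1 - ?m 1 2 (?g y) * v $ 2)) *\<^sub>R axis 1 1
        + (inverse (?det (?g y)) * (?m 1 1 (?g y) * v $ 2 - ?m 2 1 (?g y) * v $ 1)) *\<^sub>R axis 2 1" 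
      and det: "?det (?g y) \<noteq> 0" if "y \<in> f ` W" for y and v :: "real^2"
      using inv_linear_vec2[OF has_derivative_linear[OF f'[OF gW[OF that]]] inj[OF gW[OF that]]]
      unfolding vector2_eq_axis by simp_all
    show ?case
    proof (rule Ck_on_SucI[OF op g'])
      fix v :: "real^2"
      have "Ck_on k (f ` W) (\<lambda>y. (inverse (?det (?g y)) * (?m 2 2 (?g y) * v $ 1 - ?m 1 2 (?g y) * v $ 2)) *\<^sub>R axis 1 1
        + (inverse (?det (?g y)) * (?m 1 1 (?g y) * v $ 2 - ?m 2 1 (?g y) * v $ 1)) *\<^sub>R axis 2 1)"
        by (intro Ck_on_add Ck_on_scaleR Ck_on_mult Ck_on_inverse Ck_on_diff Ck_on_const m op det)
      then show "Ck_on k (f ` W) (\<lambda>y. inv (?f' (?g y)) v)"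
        by (rule Ck_on_cong[OF op, rotated]) (simp add: G)
    qed
  qed
  then show "smooth_on (f ` W) ?g" unfolding smooth_on_def by blast
qed

section \<open>Projection to a timelike plane\<close>

text \<open>Coordinates of the projection onto the plane spanned by the time axis and the spatial
  direction w, which is a complex number because it comes from the separation of curves in the
  circle.\<close>

definition plane_proj :: "complex \<Rightarrow> real^3 \<Rightarrow> real^2" where
  "plane_proj w x = vector [x $ 0, Re w * x $ 1 + Im w * x $ 2]"

definition plane_incl :: "complex \<Rightarrow> real^2 \<Rightarrow> real^3" where
  "plane_incl w y = (\<chi> i. if i = 0 then y $ 1 else if i = 1 then y $ 2 * Re w else y $ 2 * Im w)"

text \<open>The spatial part is i w, a quarter turn of w; being orthogonal to time as well, it is a
  spacelike normal when w has modulus 1.\<close>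

definition plane_normal :: "complex \<Rightarrow> real^3" where
  "plane_normal w = (\<chi> i. if i = 0 then 0 else if i = 1 then - Im w else Re w)"

definition plane_height :: "complex \<Rightarrow> real^3 \<Rightarrow> real" where
  "plane_height w x = Re w * x $ 2 - Im w * x $ 1"

lemma plane_incl_nth [simp]:
  "plane_incl w y $ 0 = y $ 1" "plane_incl w y $ 1 = y $ 2 * Re w" "plane_incl w y $ 2 = y $ 2 * Im w"
  by (simp_all add: plane_incl_def)

lemma plane_normal_nth [simp]:
  "plane_normal w $ 0 = 0" "plane_normal w $ 1 = - Im w" "plane_normal w $ 2 = Re w"
  by (simp_all add: plane_normal_def)

lemma plane_proj_nth [simp]:
  "plane_proj w x $ 1 = x $ 0" "plane_proj w x $ 2 = Re w * x $ 1 + Im w * x $ 2"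
  by (simp_all add: plane_proj_def)

lemma linear_plane_proj: "linear (plane_proj w)"
  by (rule linearI) (simp_all add: vec2_eq_iff algebra_simps)

lemma linear_plane_incl: "linear (plane_incl w)"
  by (rule linearI) (simp_all add: vec3_eq_iff algebra_simps)

lemma linear_plane_height: "linear (plane_height w)"
  by (rule linearI) (simp_all add: plane_height_def algebra_simps)

lemma cmod_1_squares:
  assumes "norm w = 1"
  shows "Re w * Re w + Im w * Im w = 1"
  using assms by (simp add: cmod_def power2_eq_square real_sqrt_eq_1_iff)

lemma plane_proj_incl:
  assumes "norm w = 1"
  shows "plane_proj w (plane_incl w y) = y"
proof -
  have "Re w * (y $ 2 * Re w) + Im w * (y $ 2 * Im w) = y $ 2 * (Re w * Re w + Im w * Im w)"
    by (simp add: algebra_simps)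
  then show ?thesis by (simp add: vec2_eq_iff cmod_1_squares[OF assms])
qed

lemma plane_decomposition:
  assumes "norm w = 1"
  shows "plane_incl w (plane_proj w x) + plane_height w x *\<^sub>R plane_normal w = x"
proof -
  have "(Re w * x $ 1 + Im w * x $ 2) * Re w + (Re w * x $ 2 - Im w * x $ 1) * - Im w = (Re w * Re w + Im w * Im w) * x $ 1"
    "(Re w * x $ 1 + Im w * x $ 2) * Im w + (Re w * x $ 2 - Im w * x $ 1) * Re w = (Re w * Re w + Im w * Im w) * x $ 2"
    by (simp_all add: algebra_simps)
  then show ?thesis
    by (simp add: vec3_eq_iff plane_height_def cmod_1_squares[OF assms])
qed

lemma inj_plane_incl:
  assumes "norm w = 1"
  shows "inj (plane_incl w)"
  using plane_proj_incl[OF assms] by (rule inj_on_inverseI)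

lemma minkowski_unit_normal_plane_normal:
  assumes "norm w = 1"
  shows "minkowski_unit_normal (range (plane_incl w)) (plane_normal w)"
  unfolding minkowski_unit_normal_def minkowski_def
  using cmod_1_squares[OF assms] by (auto simp: algebra_simps)

lemma timelike_plane_range_plane_incl:
  assumes "norm w = 1"
  shows "timelike_plane (range (plane_incl w))"
  unfolding timelike_plane_def
proof (intro conjI exI)
  let ?b = "\<lambda>i::2. plane_incl w (axis i 1)"
  have basis: "range (\<lambda>i::2. axis i (1::real)) = Basis"
    by (auto simp: Basis_vec_def)
  have rb: "range ?b = plane_incl w ` Basis"
    unfolding basis[symmetric] by auto
  show "subspace (range (plane_incl w))"
    by (rule linear_subspace_image[OF linear_plane_incl subspace_UNIV])
  show "dim (range (plane_incl w)) = 2"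
    using eucl.dim_image_eq[OF linear_plane_incl, of w UNIV] inj_plane_incl[OF assms] by simp
  show "inj ?b"
  proof (rule injI)
    fix i j :: 2 assume "?b i = ?b j"
    then have "axis i (1::real) = axis j 1" by (rule injD[OF inj_plane_incl[OF assms]])
    then show "i = j" by (simp add: axis_eq_axis)
  qed
  show "independent (range ?b)"
    unfolding rb
    by (rule linear_independent_injective_image[OF linear_plane_incl independent_Basis])
      (rule inj_on_subset[OF inj_plane_incl[OF assms] subset_UNIV])
  show "span (range ?b) = range (plane_incl w)"
    unfolding rb linear_span_image[OF linear_plane_incl] by simp
  have "det (\<chi> i j. minkowski (?b i) (?b j)) = - (Re w * Re w + Im w * Im w)"
    by (simp add: det_2 minkowski_def axis_def)
  then show "det (\<chi> i j. minkowski (?b i) (?b j)) < 0"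
    by (simp add: cmod_1_squares[OF assms])
qed

text \<open>Along the box, a change of \<open>u\<close> against a change of \<open>v\<close> is detected by the linear functional whose
  kernel separates the null directions \<open>\<alpha>'\<close> from the null directions \<open>\<beta>'\<close>, and the remaining changes
  are detected by time. The projection along \<open>plane_normal w\<close> preserves both functionals.\<close>

lemma plane_proj_injective_on_box:
  fixes \<alpha> \<beta> \<alpha>' \<beta>' :: "real \<Rightarrow> real^3"
  assumes \<alpha>: "\<And>s. (\<alpha> has_vector_derivative \<alpha>' s) (at s)" "\<And>s. \<alpha>' s $ 0 = 1"
    and \<beta>: "\<And>s. (\<beta> has_vector_derivative \<beta>' s) (at s)" "\<And>s. \<beta>' s $ 0 = 1"
    and sep: "\<And>s. s \<in> {-R..R} \<Longrightarrow> c < Re w * \<alpha>' s $ 1 + Im w * \<alpha>' s $ 2"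
      "\<And>t. t \<in> {-R..R} \<Longrightarrow> Re w * \<beta>' t $ 1 + Im w * \<beta>' t $ 2 < c"
    and box: "s1 \<in> {-R..R}" "t1 \<in> {-R..R}" "s2 \<in> {-R..R}" "t2 \<in> {-R..R}"
    and eq: "plane_proj w (\<alpha> s1 + \<beta> t1) = plane_proj w (\<alpha> s2 + \<beta> t2)"
  shows "s1 = s2 \<and> t1 = t2"
proof -
  have nth: "((\<lambda>s. \<alpha> s $ i) has_real_derivative \<alpha>' s $ i) (at s)"
    "((\<lambda>s. \<beta> s $ i) has_real_derivative \<beta>' s $ i) (at s)" for s i
    using has_derivative_vec_nth[OF \<alpha>(1)[unfolded has_vector_derivative_def, of s], of i]
      has_derivative_vec_nth[OF \<beta>(1)[unfolded has_vector_derivative_def, of s], of i]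
    by (simp_all add: has_field_derivative_def mult_commute_abs)
  \<comment> \<open>Up to an additive constant, the time of the point with null coordinates s and t
    is s + t.\<close>
  have time: "\<alpha> s $ 0 - s = \<alpha> t $ 0 - t" "\<beta> s $ 0 - s = \<beta> t $ 0 - t" for s t
  proof -
    have "((\<lambda>s. \<alpha> s $ 0 - s) has_real_derivative 0) (at s)" "((\<lambda>s. \<beta> s $ 0 - s) has_real_derivative 0) (at s)" for s
      using DERIV_diff[OF nth(1)[where i = 0] DERIV_ident] DERIV_diff[OF nth(2)[where i = 0] DERIV_ident] \<alpha>(2) \<beta>(2) by simp_all
    then show "\<alpha> s $ 0 - s = \<alpha> t $ 0 - t" "\<beta> s $ 0 - s = \<beta> t $ 0 - t"
      using DERIV_isconst_all[of "\<lambda>s. \<alpha> s $ 0 - s" s t] DERIV_isconst_all[of "\<lambda>s. \<beta> s $ 0 - s" s t] by blast+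
  qed
  \<comment> \<open>Since \<alpha>' and \<beta>' have time component 1, subtracting c times the time
    moves the separating threshold to 0: l increases along \<alpha> and decreases along
    \<beta>.\<close>
  define l :: "real^3 \<Rightarrow> real" where "l x = Re w * x $ 1 + Im w * x $ 2 - c * x $ 0" for x
  have l\<alpha>: "((\<lambda>s. l (\<alpha> s)) has_real_derivative l (\<alpha>' s)) (at s)" for s
    unfolding l_def by (intro DERIV_diff DERIV_add DERIV_cmult nth)
  have l\<beta>: "((\<lambda>s. l (\<beta> s)) has_real_derivative l (\<beta>' s)) (at s)" for s
    unfolding l_def by (intro DERIV_diff DERIV_add DERIV_cmult nth)
  have incr: "l (\<alpha> s) < l (\<alpha> t)" if "s < t" "s \<in> {-R..R}" "t \<in> {-R..R}" for s t
    by (rule DERIV_pos_imp_increasing[OF that(1)])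
      (use that l\<alpha> sep(1) \<alpha>(2) in \<open>force simp: l_def\<close>)
  have decr: "l (\<beta> t) < l (\<beta> s)" if "s < t" "s \<in> {-R..R}" "t \<in> {-R..R}" for s t
    by (rule DERIV_neg_imp_decreasing[OF that(1)])
      (use that l\<beta> sep(2) \<beta>(2) in \<open>force simp: l_def\<close>)
  have l_eq: "l (\<alpha> s1) + l (\<beta> t1) = l (\<alpha> s2) + l (\<beta> t2)"
  proof -
    have "l x + l y = plane_proj w (x + y) $ 2 - c * plane_proj w (x + y) $ 1" for x y
      unfolding l_def by (simp add: algebra_simps)
    then show ?thesis by (simp only: eq)
  qed
  have "plane_proj w (\<alpha> s1 + \<beta> t1) $ 1 = plane_proj w (\<alpha> s2 + \<beta> t2) $ 1" using eq by simp
  then have t: "s1 + t1 = s2 + t2"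
    using time[of s1 s2] time(2)[of t1 t2] by simp
  consider "s1 < s2" "t2 < t1" | "s2 < s1" "t1 < t2" | "s1 = s2" "t1 = t2" using t by linarith
  then show ?thesis
  proof cases
    case 1
    then show ?thesis using incr[of s1 s2] decr[of t2 t1] box l_eq by simp
  next
    case 2
    then show ?thesis using incr[of s2 s1] decr[of t1 t2] box l_eq by simp
  qed simp
qed

section \<open>Minimal surfaces as graphs over timelike planes\<close>

lemma minimal_surface_projection:
  assumes "smooth_immersion \<phi>" "proper_map euclidean euclidean \<phi>" "timelike \<phi>" "vanishing_mean_curvature \<phi>"
    and "compact S"
  obtains w W where "norm w = 1" "open W" "S \<subseteq> W" "inj_on (\<lambda>p. plane_proj w (\<phi> p)) W"
    "\<And>p. p \<in> W \<Longrightarrow> inj (\<lambda>h. plane_proj w (frechet_derivative \<phi> (at p) h))"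
proof -
  have smooth: "smooth_on UNIV \<phi>" and inj: "inj (frechet_derivative \<phi> (at p))" for p
    using assms(1) unfolding smooth_immersion_def by auto
  have \<phi>': "(\<phi> has_derivative frechet_derivative \<phi> (at p)) (at p)" for p
    using smooth[unfolded smooth_on_def, rule_format, of "Suc 0"] by (simp add: frechet_derivative_works)
  obtain u v u' v' \<alpha> \<beta> \<alpha>' \<beta>' where \<phi>: "\<And>p. \<phi> p = \<alpha> (u p) + \<beta> (v p)"
    and u: "\<And>p. (u has_derivative u' p) (at p)" and v: "\<And>p. (v has_derivative v' p) (at p)"
    and uv: "\<And>p q. u p = u q \<Longrightarrow> v p = v q \<Longrightarrow> p = q"
    and \<alpha>: "\<And>s. (\<alpha> has_vector_derivative \<alpha>' s) (at s)" "continuous_on UNIV \<alpha>'"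
      "\<And>s. \<alpha>' s $ 0 = 1" "\<And>s. minkowski (\<alpha>' s) (\<alpha>' s) = 0"
    and \<beta>: "\<And>s. (\<beta> has_vector_derivative \<beta>' s) (at s)" "continuous_on UNIV \<beta>'"
      "\<And>s. \<beta>' s $ 0 = 1" "\<And>s. minkowski (\<beta>' s) (\<beta>' s) = 0"
    and ne: "\<And>s t. \<alpha>' s \<noteq> \<beta>' t"
    by (rule minimal_surface_null_coordinates[OF assms(1-4)]) (rule that)
  have cu: "continuous_on UNIV u" and cv: "continuous_on UNIV v"
    by (intro continuous_at_imp_continuous_on ballI has_derivative_continuous[OF u] has_derivative_continuous[OF v])+
  have "bounded (u ` S)" "bounded (v ` S)"
    using assms(5) cu cv by (auto intro!: compact_imp_bounded compact_continuous_image intro: continuous_on_subset)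
  then obtain R1 R2 where R12: "\<And>p. p \<in> S \<Longrightarrow> \<bar>u p\<bar> \<le> R1" "\<And>p. p \<in> S \<Longrightarrow> \<bar>v p\<bar> \<le> R2"
    unfolding bounded_iff by (auto simp: image_iff)
  \<comment> \<open>The summand 1 puts S into the open box; the 0 keeps R positive even for empty S,
    when \<open>R1\<close> and \<open>R2\<close> may be negative.\<close>
  define R where "R = max 0 (max R1 R2) + 1"
  have R: "R > 0" unfolding R_def by linarith
  define W where "W = {p. \<bar>u p\<bar> < R \<and> \<bar>v p\<bar> < R}"
  define a where "a s = Complex (\<alpha>' s $ 1) (\<alpha>' s $ 2)" for s
  define b where "b s = Complex (\<beta>' s $ 1) (\<beta>' s $ 2)" for s
  have "continuous_on UNIV a" "continuous_on UNIV b"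
    unfolding a_def b_def Complex_eq by (intro continuous_intros \<alpha>(2) \<beta>(2))+
  \<comment> \<open>A null vector with time component 1 has a spatial part of length 1.\<close>
  moreover have "norm (a s) = 1" "norm (b s) = 1" for s
    using \<alpha>(4)[of s] \<beta>(4)[of s] unfolding a_def b_def minkowski_def
    by (simp_all add: cmod_def \<alpha>(3) \<beta>(3) power2_eq_square)
  moreover have "a s \<noteq> b t" for s t
    using ne[of s t] unfolding a_def b_def vec3_eq_iff by (simp add: \<alpha>(3) \<beta>(3))
  moreover have "compact {-R..R}" "{-R..R} \<noteq> {}" using R by auto
  ultimately obtain w c where w: "norm w = 1"
    and sep: "\<And>s. s \<in> {-R..R} \<Longrightarrow> c < w \<bullet> a s" "\<And>t. t \<in> {-R..R} \<Longrightarrow> w \<bullet> b t < c"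
    using disjoint_circle_curves_separation[of a b "{-R..R}" "{-R..R}"] by metis
  have sep': "s \<in> {-R..R} \<Longrightarrow> c < Re w * \<alpha>' s $ 1 + Im w * \<alpha>' s $ 2"
    "s \<in> {-R..R} \<Longrightarrow> Re w * \<beta>' s $ 1 + Im w * \<beta>' s $ 2 < c" for s
    using sep[of s] unfolding a_def b_def by (simp_all add: inner_complex_def)
  show ?thesis
  proof (rule that[of w W])
    show "open W"
      unfolding W_def by (intro open_Collect_conj open_Collect_less continuous_intros cu cv)
    show "S \<subseteq> W"
    proof
      fix p assume "p \<in> S"
      then show "p \<in> W" using R12(1)[of p] R12(2)[of p] unfolding W_def R_def by auto
    qed
    show "inj_on (\<lambda>p. plane_proj w (\<phi> p)) W"
    proof (rule inj_onI)
      fix p q assume pq: "p \<in> W" "q \<in> W" "plane_proj w (\<phi> p) = plane_proj w (\<phi> q)"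
      have "u p = u q \<and> v p = v q"
        by (rule plane_proj_injective_on_box[OF \<alpha>(1,3) \<beta>(1,3) sep', of R "u p" "v p" "u q" "v q"])
          (use pq in \<open>auto simp: W_def \<phi>\<close>)
      then show "p = q" using uv by blast
    qed
    fix p assume p: "p \<in> W"
    have "(\<phi> has_derivative (\<lambda>h. u' p h *\<^sub>R \<alpha>' (u p) + v' p h *\<^sub>R \<beta>' (v p))) (at p)"
      using has_derivative_add[OF has_derivative_compose[OF u \<alpha>(1)[unfolded has_vector_derivative_def]]
          has_derivative_compose[OF v \<beta>(1)[unfolded has_vector_derivative_def]], of p]
      by (simp only: \<phi>[symmetric])
    then have d: "frechet_derivative \<phi> (at p) = (\<lambda>h. u' p h *\<^sub>R \<alpha>' (u p) + v' p h *\<^sub>R \<beta>' (v p))"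
      by (rule has_derivative_unique[OF \<phi>'])
    have lin: "linear (\<lambda>h. plane_proj w (frechet_derivative \<phi> (at p) h))"
      using linear_compose[OF has_derivative_linear[OF \<phi>'] linear_plane_proj] by (simp add: o_def)
    show "inj (\<lambda>h. plane_proj w (frechet_derivative \<phi> (at p) h))"
    proof (rule iffD2[OF linear_injective_0[OF lin]], intro allI impI)
      fix h assume h: "plane_proj w (frechet_derivative \<phi> (at p) h) = 0"
      \<comment> \<open>Time and the functional given by w yield a linear system for
        \<open>u' p h\<close> and \<open>v' p h\<close> with rows (1, 1) and (?x, ?y), regular
        because \<open>?y < ?x\<close>.\<close>
      let ?x = "Re w * \<alpha>' (u p) $ 1 + Im w * \<alpha>' (u p) $ 2" and ?y = "Re w * \<beta>' (v p) $ 1 + Im w * \<beta>' (v p) $ 2"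
      have "u' p h + v' p h = 0"
        using h unfolding d vec2_eq_iff by (simp add: \<alpha>(3) \<beta>(3))
      moreover have "u' p h * ?x + v' p h * ?y = 0"
        using h unfolding d vec2_eq_iff by (simp add: algebra_simps)
      ultimately have "u' p h * (?x - ?y) = 0" 
        by (simp add: eq_neg_iff_add_eq_0[symmetric] right_diff_distrib)
      moreover have "?y < ?x"
        using sep'(1)[of "u p"] sep'(2)[of "v p"] p unfolding W_def by force
      ultimately have "u' p h = 0" "v' p h = 0"
        using \<open>u' p h + v' p h = 0\<close> by auto
      then have "frechet_derivative \<phi> (at p) h = 0" unfolding d by simp
      then show "h = 0"
        using inj[of p] linear_injective_0[OF has_derivative_linear[OF \<phi>'], of p] by blast
    qed
  qed (fact w)
qed

text \<open>The graph function is the height of \<open>\<phi>\<close> after the inverse of the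
  projected map, so its smoothness rests on that of \<open>\<phi>\<close> and of the inverse. This
  is why injectivity is asked on an open W around S and for the derivative too.\<close>

lemma smooth_graph_over_of_projection:
  fixes \<phi> :: "real^2 \<Rightarrow> real^3"
  assumes smooth: "smooth_on UNIV \<phi>" and w: "norm w = 1" and "open W" "S \<subseteq> W"
    and inj: "inj_on (\<lambda>p. plane_proj w (\<phi> p)) W"
    and inj': "\<And>p. p \<in> W \<Longrightarrow> inj (\<lambda>h. plane_proj w (frechet_derivative \<phi> (at p) h))"
  shows "smooth_graph_over (\<phi> ` S) (range (plane_incl w))"
proof -
  define f where "f p = plane_proj w (\<phi> p)" for p
  let ?g = "inv_into W f"
  have Ck: "Ck_on k UNIV \<phi>" for k using smooth unfolding smooth_on_def by blast
  have bl: "bounded_linear (plane_proj w)" "bounded_linear (plane_height w)"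
    using linear_plane_proj linear_plane_height by (simp_all add: linear_conv_bounded_linear)
  have "smooth_on W f"
    unfolding smooth_on_def f_def[abs_def]
    by (intro allI Ck_on_bounded_linear[OF \<open>open W\<close> bl(1)] Ck_on_subset[OF Ck subset_UNIV])
  moreover have injf: "inj_on f W" using inj unfolding f_def[abs_def] .
  moreover have "inj (frechet_derivative f (at p))" if "p \<in> W" for p
  proof -
    have "(f has_derivative (\<lambda>h. plane_proj w (frechet_derivative \<phi> (at p) h))) (at p)"
      unfolding f_def[abs_def]
      by (intro bounded_linear.has_derivative[OF bl(1)] Ck_on_Suc_has_derivative[OF Ck]) simp
    then show ?thesis using inj'[OF that] frechet_derivative_at by metis
  qed
  ultimately have g: "open (f ` W)" "smooth_on (f ` W) ?g"
    using smooth_on_inv_into[OF \<open>open W\<close>, of f] by blast+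
  define U where "U = plane_incl w ` f ` W"
  define D where "D = plane_incl w ` f ` S"
  define h where "h x = plane_height w (\<phi> (?g (plane_proj w x)))" for x
  have vU: "plane_incl w -` U = f ` W"
    unfolding U_def by (rule inj_vimage_image_eq[OF inj_plane_incl[OF w]])
  have "openin (top_of_set (range (plane_incl w))) U"
  proof -
    have "open (plane_proj w -` (f ` W))"
      using linear_continuous_on[OF bl(1), of UNIV] g(1) by (auto simp: continuous_on_open_vimage[OF open_UNIV])
    moreover have "U = range (plane_incl w) \<inter> plane_proj w -` (f ` W)"
      unfolding U_def using plane_proj_incl[OF w] by auto
    ultimately show ?thesis by (auto simp: openin_open)
  qed
  moreover have "smooth_on_plane (range (plane_incl w)) U h"
    unfolding smooth_on_plane_def
  proof (intro exI conjI)
    have "Ck_on k (f ` W) (\<lambda>y. plane_height w (\<phi> (?g y)))" for k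
    proof (rule Ck_on_bounded_linear[OF g(1) bl(2) Ck_on_compose[OF g(1) _ Ck subset_UNIV]])
      show "Ck_on k (f ` W) ?g" using g(2) unfolding smooth_on_def by blast
    qed
    moreover have "h \<circ> plane_incl w = (\<lambda>y. plane_height w (\<phi> (?g y)))"
      unfolding h_def by (auto simp: plane_proj_incl[OF w])
    ultimately show "smooth_on (plane_incl w -` U) (h \<circ> plane_incl w)"
      unfolding vU smooth_on_def by simp
  qed (use linear_plane_incl inj_plane_incl[OF w] in auto)
  moreover have "\<phi> ` S = (\<lambda>p. p + h p *\<^sub>R plane_normal w) ` D"
  proof -
    have "plane_incl w (f p) + h (plane_incl w (f p)) *\<^sub>R plane_normal w = \<phi> p" if "p \<in> S" for p
    proof -
      have "?g (f p) = p" using inv_into_f_f[OF injf] that \<open>S \<subseteq> W\<close> by blast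
      then show ?thesis
        using plane_decomposition[OF w, of "\<phi> p"] unfolding h_def plane_proj_incl[OF w] by (simp add: f_def)
    qed
    then show ?thesis unfolding D_def image_image by (intro image_cong) simp_all
  qed
  moreover have "D \<subseteq> U" unfolding D_def U_def using \<open>S \<subseteq> W\<close> by blast
  ultimately show ?thesis
    unfolding smooth_graph_over_def using minkowski_unit_normal_plane_normal[OF w] by blast
qed

theorem theorem1p1:
  fixes \<phi> :: "real^2 \<Rightarrow> real^3"
  assumes "smooth_immersion \<phi>"
    and "proper_map euclidean euclidean \<phi>"
    and "timelike \<phi>"
    and "vanishing_mean_curvature \<phi>"
  shows "smooth_embedding \<phi> \<and>
    (\<forall>K. compact K \<and> K \<subseteq> range \<phi> \<longrightarrow>
      (\<exists>P. timelike_plane P \<and> smooth_graph_over K P))"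
proof (intro conjI allI impI)
  have smooth: "smooth_on UNIV \<phi>"
    using assms(1) unfolding smooth_immersion_def by blast
  have "inj \<phi>"
  proof (rule injI)
    fix p q assume eq: "\<phi> p = \<phi> q"
    \<comment> \<open>Applied to the compact set of the two points: equal images have equal
      projections, which are injective near that set.\<close>
    obtain w W where W: "{p, q} \<subseteq> W" "inj_on (\<lambda>p. plane_proj w (\<phi> p)) W"
      by (rule minimal_surface_projection[OF assms, of "{p, q}"]) (simp, rule that)
    show "p = q" by (rule inj_onD[OF W(2)]) (use W(1) eq in simp_all)
  qed
  moreover have "continuous_on UNIV \<phi>"
    using smooth[unfolded smooth_on_def, rule_format, of 0] by simp
  ultimately have "embedding_map euclidean euclidean \<phi>"
    using proper_imp_closed_map[OF assms(2)] by (intro injective_closed_imp_embedding_map) simp_all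
  then show "smooth_embedding \<phi>"
    using assms(1) unfolding smooth_embedding_def by blast
next
  fix K assume K: "compact K \<and> K \<subseteq> range \<phi>"
  let ?S = "{p. \<phi> p \<in> K}"
  have "compact ?S"
    using compactin_proper_map_preimage[OF assms(2), of K] K by simp
  then obtain w W where w: "norm w = 1" "open W" "?S \<subseteq> W" "inj_on (\<lambda>p. plane_proj w (\<phi> p)) W"
    "\<And>p. p \<in> W \<Longrightarrow> inj (\<lambda>h. plane_proj w (frechet_derivative \<phi> (at p) h))"
    by (rule minimal_surface_projection[OF assms]) (rule that)
  have "smooth_graph_over (\<phi> ` ?S) (range (plane_incl w))"
    by (rule smooth_graph_over_of_projection[OF _ w]) (use assms(1) in \<open>simp add: smooth_immersion_def\<close>)
  moreover have "\<phi> ` ?S = K" using K by auto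
  ultimately show "\<exists>P. timelike_plane P \<and> smooth_graph_over K P"
    using timelike_plane_range_plane_incl[OF w(1)] by auto
qed

end
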